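(* Let $R$ be a Noetherian $F$-finite and $F$-split ring of characteristic $p>0$ which is either local, or a $\mathbb Z_{\ge0}$-graded ring $R=\bigoplus_{n\ge0}R_n$ with $(R_0,\mathfrak m_0)$ local and $R=R_0[R_1]$ finitely generated over $R_0$. Let $\mathbb I=\{I_n\}_{n\ge0}$ be an $F$-split filtration of ideals of $R$. Then: (1) $\mathrm{depth}(I_n)\le\mathrm{depth}(I_{\lceil n/p^e\rceil})$ for all integers $n,e\ge0$. (2) If $R$ is graded, then $a_i(I_n)\ge p^e\,a_i(I_{\lceil n/p^e\rceil})$ for all integers $n,e\ge0$ and all $0\le i\le\dim(R/I_1)$.
   Context: A ring $A$ of characteristic $p$ is $F$-finite if it is a finitely generated module over itself via the Frobenius $F$, and $F$-split if $F:A\to A$ is a split monomorphism. An $F$-split filtration is a sequence of ideals $\mathbb I=\{I_n\}_{n\ge0}$ of $R$ (homogeneous in the graded case) with $I_0=R$, $I_{n+1}\subseteq I_n$ and $I_nI_m\subseteq I_{n+m}$ for all $n,m\ge0$, such that there is an $R$-linear map $\phi:R^{1/p}\to R$ with $\phi|_R=\mathrm{id}_R$ and $\phi\big((I_{np+1})^{1/p}\big)\subseteq I_{n+1}$ for every $n\ge0$, where $R^{1/p}$ is the ring of $p$-th roots of elements of $R$ and $J^{1/p}=\{f^{1/p}\mid f\in J\}$. In the graded case all objects are assumed homogeneous. Depth of a module is with respect to the maximal ideal $\mathfrak m$ of $R$ in the local case and with respect to $\mathfrak m=\mathfrak m_0+R_+$ in the graded case, where $R_+=\bigoplus_{n>0}R_n$.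 For a graded $R$-module $M$, $a_i(M)=\max\{n\mid [H^i_{R_+}(M)]_n\ne0\}$ if $H^i_{R_+}(M)\neq0$, and $a_i(M)=-\infty$ otherwise. *)

theory Defs
  imports
    "HOL-Algebra.Algebra"
    "HOL-Library.Extended_Nat"
    "HOL-Library.Extended_Real"
begin

text \<open>Modules over a ring \<open>R\<close> are \<open>module\<close> records. The fields \<open>mult\<close> and \<open>one\<close>, which a module
  inherits from the \<open>ring\<close> record, carry no information unless the module is also a ring.\<close>

section \<open>Modules\<close>

definition ideal_module :: "('a, 'm) ring_scheme \<Rightarrow> 'a set \<Rightarrow> ('a, 'a) module" where
  "ideal_module R J =
     \<lparr>carrier = J, monoid.mult = monoid.mult R, one = one R, ring.zero = ring.zero R,
      ring.add = ring.add R, smult = monoid.mult R\<rparr>"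

definition lin_maps ::
  "('a, 'm) ring_scheme \<Rightarrow> ('a, 'b, 'n) module_scheme \<Rightarrow> ('a, 'c, 'k) module_scheme \<Rightarrow> ('b \<Rightarrow> 'c) set"
where
  "lin_maps R M N = {h \<in> carrier M \<rightarrow> carrier N.
     (\<forall>x\<in>carrier M. \<forall>y\<in>carrier M. h (x \<oplus>\<^bsub>M\<^esub> y) = h x \<oplus>\<^bsub>N\<^esub> h y) \<and>
     (\<forall>a\<in>carrier R. \<forall>x\<in>carrier M. h (a \<odot>\<^bsub>M\<^esub> x) = a \<odot>\<^bsub>N\<^esub> h x)}"

definition mod_span :: "('a, 'm) ring_scheme \<Rightarrow> ('a, 'b, 'n) module_scheme \<Rightarrow> 'b set \<Rightarrow> 'b set" where
  "mod_span R M S = \<Inter>{N. submodule N R M \<and> S \<subseteq> N}"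

definition fin_gen_module :: "('a, 'm) ring_scheme \<Rightarrow> ('a, 'b, 'n) module_scheme \<Rightarrow> bool" where
  "fin_gen_module R M \<longleftrightarrow> (\<exists>S. finite S \<and> S \<subseteq> carrier M \<and> mod_span R M S = carrier M)"

section \<open>Frobenius\<close>

definition char_p :: "nat \<Rightarrow> ('a, 'm) ring_scheme \<Rightarrow> bool" where
  "char_p p R \<longleftrightarrow> Factorial_Ring.prime p \<and> \<one>\<^bsub>R\<^esub> \<noteq> \<zero>\<^bsub>R\<^esub> \<and> add_pow R p \<one>\<^bsub>R\<^esub> = \<zero>\<^bsub>R\<^esub>"

text \<open>The ring \<open>R\<close> as a module over itself via the Frobenius \<open>a \<mapsto> a\<^sup>p\<close>, which then is
  an \<open>R\<close>-linear map from \<open>R\<close> to this module.\<close>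

definition frobenius_module :: "nat \<Rightarrow> ('a, 'm) ring_scheme \<Rightarrow> ('a, 'a) module" where
  "frobenius_module p R =
     \<lparr>carrier = carrier R, monoid.mult = monoid.mult R, one = one R, ring.zero = ring.zero R,
      ring.add = ring.add R,
      smult = (\<lambda>a x. (a [^]\<^bsub>R\<^esub> p) \<otimes>\<^bsub>R\<^esub> x)\<rparr>"

definition F_finite :: "nat \<Rightarrow> ('a, 'm) ring_scheme \<Rightarrow> bool" where
  "F_finite p R \<longleftrightarrow> fin_gen_module R (frobenius_module p R)"

definition F_split :: "nat \<Rightarrow> ('a, 'm) ring_scheme \<Rightarrow> bool" where
  "F_split p R \<longleftrightarrow>
     (\<exists>\<psi>\<in>lin_maps R (frobenius_module p R) (ideal_module R (carrier R)).
        \<forall>a\<in>carrier R. \<psi> (a [^]\<^bsub>R\<^esub> p) = a)"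

text \<open>The formal \<open>p\<close>-th root \<open>f\<^sup>1\<^sup>/\<^sup>p\<close> of \<open>f\<close> is \<open>Root f\<close>, so the selector \<open>pth_power\<close> is
  the \<open>p\<close>-th power map from \<open>R\<^sup>1\<^sup>/\<^sup>p\<close> to \<open>R\<close>. An \<open>F\<close>-split ring is reduced of characteristic
  \<open>p\<close>, hence \<open>p\<close>-th roots are unique, sums and products of roots are roots of sums and products,
  and \<open>a\<close> is identified with the root of \<open>a\<^sup>p\<close>.\<close>

datatype 'a pth_root = Root (pth_power: 'a)

definition root_ring :: "nat \<Rightarrow> ('a, 'm) ring_scheme \<Rightarrow> ('a, 'a pth_root) module" where
  "root_ring p R =
     \<lparr>carrier = Root ` carrier R,
      monoid.mult = (\<lambda>x y. Root (pth_power x \<otimes>\<^bsub>R\<^esub> pth_power y)),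
      one = Root \<one>\<^bsub>R\<^esub>,
      ring.zero = Root \<zero>\<^bsub>R\<^esub>,
      ring.add = (\<lambda>x y. Root (pth_power x \<oplus>\<^bsub>R\<^esub> pth_power y)),
      smult = (\<lambda>a x. Root ((a [^]\<^bsub>R\<^esub> p) \<otimes>\<^bsub>R\<^esub> pth_power x))\<rparr>"

definition root_incl :: "nat \<Rightarrow> ('a, 'm) ring_scheme \<Rightarrow> 'a \<Rightarrow> 'a pth_root" where
  "root_incl p R a = Root (a [^]\<^bsub>R\<^esub> p)"

lemma root_ring_pow:
  fixes k :: nat
  shows "Root f [^]\<^bsub>root_ring p R\<^esub> k = Root (f [^]\<^bsub>R\<^esub> k)"
  by (induction k) (simp_all add: root_ring_def nat_pow_def)

lemma root_ring_pth_power: "x [^]\<^bsub>root_ring p R\<^esub> p = root_incl p R (pth_power x)"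
  by (cases x) (simp add: root_ring_pow root_incl_def)

lemma root_ring_smult: "a \<odot>\<^bsub>root_ring p R\<^esub> x = root_incl p R a \<otimes>\<^bsub>root_ring p R\<^esub> x"
  by (simp add: root_ring_def root_incl_def)

section \<open>Local and graded rings\<close>

definition local_ring :: "('a, 'm) ring_scheme \<Rightarrow> 'a set \<Rightarrow> bool" where
  "local_ring R \<mm> \<longleftrightarrow> cring R \<and> maximalideal \<mm> R \<and> (\<forall>\<nn>. maximalideal \<nn> R \<longrightarrow> \<nn> = \<mm>)"

definition homog_decomp :: "('a, 'm) ring_scheme \<Rightarrow> (nat \<Rightarrow> 'a set) \<Rightarrow> 'a \<Rightarrow> (nat \<Rightarrow> 'a) \<Rightarrow> bool" where
  "homog_decomp R G x c \<longleftrightarrow>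
     (\<forall>n. c n \<in> G n) \<and> finite {n. c n \<noteq> \<zero>\<^bsub>R\<^esub>} \<and> x = finsum R c {n. c n \<noteq> \<zero>\<^bsub>R\<^esub>}"

definition graded_ring :: "('a, 'm) ring_scheme \<Rightarrow> (nat \<Rightarrow> 'a set) \<Rightarrow> bool" where
  "graded_ring R G \<longleftrightarrow>
     cring R \<and> (\<forall>n. additive_subgroup (G n) R) \<and> \<one>\<^bsub>R\<^esub> \<in> G 0 \<and>
     (\<forall>i j. \<forall>a\<in>G i. \<forall>b\<in>G j. a \<otimes>\<^bsub>R\<^esub> b \<in> G (i + j)) \<and>
     (\<forall>x\<in>carrier R. \<exists>!c. homog_decomp R G x c)"

definition homog_comp :: "('a, 'm) ring_scheme \<Rightarrow> (nat \<Rightarrow> 'a set) \<Rightarrow> 'a \<Rightarrow> nat \<Rightarrow> 'a" where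
  "homog_comp R G x = (THE c. homog_decomp R G x c)"

definition homog_ideal :: "('a, 'm) ring_scheme \<Rightarrow> (nat \<Rightarrow> 'a set) \<Rightarrow> 'a set \<Rightarrow> bool" where
  "homog_ideal R G J \<longleftrightarrow> ideal J R \<and> (\<forall>x\<in>J. \<forall>n. homog_comp R G x n \<in> J)"

definition standard_graded :: "('a, 'm) ring_scheme \<Rightarrow> (nat \<Rightarrow> 'a set) \<Rightarrow> 'a set \<Rightarrow> bool" where
  "standard_graded R G \<mm>\<^sub>0 \<longleftrightarrow>
     graded_ring R G \<and> local_ring (R\<lparr>carrier := G 0\<rparr>) \<mm>\<^sub>0 \<and>
     generate_ring R (G 0 \<union> G 1) = carrier R \<and>
     (\<exists>S. finite S \<and> S \<subseteq> carrier R \<and> generate_ring R (G 0 \<union> S) = carrier R)"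

definition irrelevant_ideal :: "('a, 'm) ring_scheme \<Rightarrow> (nat \<Rightarrow> 'a set) \<Rightarrow> 'a set" where
  "irrelevant_ideal R G = {x \<in> carrier R. homog_comp R G x 0 = \<zero>\<^bsub>R\<^esub>}"

definition graded_max_ideal :: "('a, 'm) ring_scheme \<Rightarrow> (nat \<Rightarrow> 'a set) \<Rightarrow> 'a set \<Rightarrow> 'a set" where
  "graded_max_ideal R G \<mm>\<^sub>0 = \<mm>\<^sub>0 <+>\<^bsub>R\<^esub> irrelevant_ideal R G"

section \<open>\<open>F\<close>-split filtrations\<close>

definition ideal_filtration :: "('a, 'm) ring_scheme \<Rightarrow> (nat \<Rightarrow> 'a set) \<Rightarrow> bool" where
  "ideal_filtration R I \<longleftrightarrow>
     (\<forall>n. ideal (I n) R) \<and> I 0 = carrier R \<and> (\<forall>n. I (Suc n) \<subseteq> I n) \<and>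
     (\<forall>n m. ideal_prod R (I n) (I m) \<subseteq> I (n + m))"

definition filtration_splitting ::
  "nat \<Rightarrow> ('a, 'm) ring_scheme \<Rightarrow> (nat \<Rightarrow> 'a set) \<Rightarrow> ('a pth_root \<Rightarrow> 'a) \<Rightarrow> bool" where
  "filtration_splitting p R I \<phi> \<longleftrightarrow>
     \<phi> \<in> lin_maps R (root_ring p R) (ideal_module R (carrier R)) \<and>
     (\<forall>a\<in>carrier R. \<phi> (root_incl p R a) = a) \<and>
     (\<forall>n. \<phi> ` (Root ` I (n * p + 1)) \<subseteq> I (n + 1))"

definition F_split_filtration :: "nat \<Rightarrow> ('a, 'm) ring_scheme \<Rightarrow> (nat \<Rightarrow> 'a set) \<Rightarrow> bool" where
  "F_split_filtration p R I \<longleftrightarrow> ideal_filtration R I \<and> (\<exists>\<phi>. filtration_splitting p R I \<phi>)"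

text \<open>In \<open>R\<^sup>1\<^sup>/\<^sup>p\<close> the root of an element of degree \<open>k\<close> has degree \<open>k/p\<close>. A homogeneous map that
  restricts to the identity on \<open>R\<close> has degree \<open>0\<close>.\<close>

definition homog_root_map ::
  "nat \<Rightarrow> ('a, 'm) ring_scheme \<Rightarrow> (nat \<Rightarrow> 'a set) \<Rightarrow> ('a pth_root \<Rightarrow> 'a) \<Rightarrow> bool" where
  "homog_root_map p R G \<phi> \<longleftrightarrow>
     (\<forall>k. \<forall>f\<in>G k. \<phi> (Root f) \<in> (if p dvd k then G (k div p) else {\<zero>\<^bsub>R\<^esub>}))"

definition graded_F_split_filtration ::
  "nat \<Rightarrow> ('a, 'm) ring_scheme \<Rightarrow> (nat \<Rightarrow> 'a set) \<Rightarrow> (nat \<Rightarrow> 'a set) \<Rightarrow> bool" where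
  "graded_F_split_filtration p R G I \<longleftrightarrow>
     ideal_filtration R I \<and> (\<forall>n. homog_ideal R G (I n)) \<and>
     (\<exists>\<phi>. filtration_splitting p R I \<phi> \<and> homog_root_map p R G \<phi>)"

section \<open>Depth and dimension\<close>

definition ideal_mult :: "('a, 'm) ring_scheme \<Rightarrow> 'a set \<Rightarrow> ('a, 'b, 'n) module_scheme \<Rightarrow> 'b set" where
  "ideal_mult R J M = mod_span R M {a \<odot>\<^bsub>M\<^esub> z |a z. a \<in> J \<and> z \<in> carrier M}"

text \<open>The middle clause says that \<open>xs ! i\<close> is a nonzerodivisor on
  \<open>M / (xs ! 0, \<dots>, xs ! (i - 1)) M\<close>.\<close>

definition regular_seq :: "('a, 'm) ring_scheme \<Rightarrow> ('a, 'b, 'n) module_scheme \<Rightarrow> 'a list \<Rightarrow> bool" where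
  "regular_seq R M xs \<longleftrightarrow>
     set xs \<subseteq> carrier R \<and>
     (\<forall>i<length xs. \<forall>z\<in>carrier M.
        xs ! i \<odot>\<^bsub>M\<^esub> z \<in> ideal_mult R (set (take i xs)) M \<longrightarrow>
        z \<in> ideal_mult R (set (take i xs)) M) \<and>
     ideal_mult R (set xs) M \<noteq> carrier M"

text \<open>By the usual convention the depth is infinite if \<open>\<mm>M = M\<close>, in particular if \<open>M = 0\<close>.\<close>

definition depth :: "('a, 'm) ring_scheme \<Rightarrow> 'a set \<Rightarrow> ('a, 'b, 'n) module_scheme \<Rightarrow> enat" where
  "depth R \<mm> M =
     (if ideal_mult R \<mm> M = carrier M then \<infinity>
      else Sup {enat (length xs) |xs. set xs \<subseteq> \<mm> \<and> regular_seq R M xs})"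

text \<open>The Krull dimension of the zero ring is \<open>Sup {} = -\<infinity>\<close>.\<close>

definition krull_dim :: "('a, 'm) ring_scheme \<Rightarrow> ereal" where
  "krull_dim R =
     Sup {ereal (real l) |l. \<exists>P. (\<forall>i\<le>l. primeideal (P i) R) \<and> (\<forall>i<l. P i \<subset> P (Suc i))}"

section \<open>Localization of a module at an element\<close>

text \<open>\<open>loc_frac R M f m k\<close> is the fraction \<open>m / f\<^sup>k\<close>, the class of the pair \<open>(m, k)\<close>.\<close>

definition loc_frac ::
  "('a, 'm) ring_scheme \<Rightarrow> ('a, 'b, 'n) module_scheme \<Rightarrow> 'a \<Rightarrow> 'b \<Rightarrow> nat \<Rightarrow> ('b \<times> nat) set" where
  "loc_frac R M f m k =
     {(m', k'). m' \<in> carrier M \<and>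
        (\<exists>t::nat. (f [^]\<^bsub>R\<^esub> t) \<odot>\<^bsub>M\<^esub> ((f [^]\<^bsub>R\<^esub> k') \<odot>\<^bsub>M\<^esub> m) =
                   (f [^]\<^bsub>R\<^esub> t) \<odot>\<^bsub>M\<^esub> ((f [^]\<^bsub>R\<^esub> k) \<odot>\<^bsub>M\<^esub> m'))}"

definition loc_module ::
  "('a, 'm) ring_scheme \<Rightarrow> ('a, 'b, 'n) module_scheme \<Rightarrow> 'a \<Rightarrow> ('a, ('b \<times> nat) set) module" where
  "loc_module R M f =
     \<lparr>carrier = {loc_frac R M f m k |m k. m \<in> carrier M},
      monoid.mult = undefined,
      one = undefined,
      ring.zero = loc_frac R M f \<zero>\<^bsub>M\<^esub> 0,
      ring.add = (\<lambda>u v. \<Union>((\<lambda>((m, k), (m', k')).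
               loc_frac R M f (((f [^]\<^bsub>R\<^esub> k') \<odot>\<^bsub>M\<^esub> m) \<oplus>\<^bsub>M\<^esub> ((f [^]\<^bsub>R\<^esub> k) \<odot>\<^bsub>M\<^esub> m')) (k + k'))
               ` (u \<times> v))),
      smult = (\<lambda>a u. \<Union>((\<lambda>(m, k). loc_frac R M f (a \<odot>\<^bsub>M\<^esub> m) k) ` u))\<rparr>"

text \<open>The canonical map from \<open>M\<^sub>f\<close> to \<open>M\<^sub>h\<close> for \<open>h = f g\<close>, sending \<open>m / f\<^sup>k\<close> to
  \<open>g\<^sup>k m / h\<^sup>k\<close>.\<close>

definition loc_map ::
  "('a, 'm) ring_scheme \<Rightarrow> ('a, 'b, 'n) module_scheme \<Rightarrow> 'a \<Rightarrow> 'a \<Rightarrow> ('b \<times> nat) set \<Rightarrow> ('b \<times> nat) set"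
where
  "loc_map R M g h u = \<Union>((\<lambda>(m, k). loc_frac R M h ((g [^]\<^bsub>R\<^esub> k) \<odot>\<^bsub>M\<^esub> m) k) ` u)"

text \<open>The part of degree \<open>n\<close> of \<open>M\<^sub>f\<close>, for \<open>M\<close> graded by \<open>D\<close> and \<open>f\<close> homogeneous of degree \<open>d\<close>.\<close>

definition loc_degree ::
  "('a, 'm) ring_scheme \<Rightarrow> ('a, 'b, 'n) module_scheme \<Rightarrow> (int \<Rightarrow> 'b set) \<Rightarrow> 'a \<Rightarrow> nat \<Rightarrow> int \<Rightarrow>
     ('b \<times> nat) set set" where
  "loc_degree R M D f d n = {loc_frac R M f m k |m k. m \<in> D (n + int (k * d))}"

section \<open>Local cohomology\<close>

text \<open>The local cohomology of \<open>M\<close> with support in the ideal generated by the list \<open>ys\<close> is the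
  cohomology of the Cech complex, whose term in degree \<open>i\<close> is the direct sum of the localizations
  of \<open>M\<close> at the products \<open>y\<^sub>J\<close> of the \<open>y\<^sub>j\<close> with \<open>j \<in> J\<close>, where \<open>J\<close> has \<open>i\<close> elements.\<close>

definition cech_index :: "'a list \<Rightarrow> nat \<Rightarrow> nat set set" where
  "cech_index ys i = {J. J \<subseteq> {..<length ys} \<and> card J = i}"

definition cech_elem :: "('a, 'm) ring_scheme \<Rightarrow> 'a list \<Rightarrow> nat set \<Rightarrow> 'a" where
  "cech_elem R ys J = finprod R (\<lambda>j. ys ! j) J"

definition cech_module ::
  "('a, 'm) ring_scheme \<Rightarrow> ('a, 'b, 'n) module_scheme \<Rightarrow> 'a list \<Rightarrow> nat \<Rightarrow>
     ('a, nat set \<Rightarrow> ('b \<times> nat) set) module" where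
  "cech_module R M ys i =
     \<lparr>carrier = (\<Pi>\<^sub>E J\<in>cech_index ys i. carrier (loc_module R M (cech_elem R ys J))),
      monoid.mult = undefined,
      one = undefined,
      ring.zero = (\<lambda>J\<in>cech_index ys i. \<zero>\<^bsub>loc_module R M (cech_elem R ys J)\<^esub>),
      ring.add = (\<lambda>c c'. \<lambda>J\<in>cech_index ys i. c J \<oplus>\<^bsub>loc_module R M (cech_elem R ys J)\<^esub> c' J),
      smult = (\<lambda>a c. \<lambda>J\<in>cech_index ys i. a \<odot>\<^bsub>loc_module R M (cech_elem R ys J)\<^esub> c J)\<rparr>"

definition cech_diff ::
  "('a, 'm) ring_scheme \<Rightarrow> ('a, 'b, 'n) module_scheme \<Rightarrow> 'a list \<Rightarrow> nat \<Rightarrow>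
     (nat set \<Rightarrow> ('b \<times> nat) set) \<Rightarrow> (nat set \<Rightarrow> ('b \<times> nat) set)" where
  "cech_diff R M ys i c = (\<lambda>K\<in>cech_index ys (Suc i).
     finsum (loc_module R M (cech_elem R ys K))
       (\<lambda>k. ((\<ominus>\<^bsub>R\<^esub> \<one>\<^bsub>R\<^esub>) [^]\<^bsub>R\<^esub> card {j \<in> K. j < k}) \<odot>\<^bsub>loc_module R M (cech_elem R ys K)\<^esub>
             loc_map R M (ys ! k) (cech_elem R ys K) (c (K - {k})))
       K)"

definition cech_cocycles ::
  "('a, 'm) ring_scheme \<Rightarrow> ('a, 'b, 'n) module_scheme \<Rightarrow> 'a list \<Rightarrow> nat \<Rightarrow>
     (nat set \<Rightarrow> ('b \<times> nat) set) set" where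
  "cech_cocycles R M ys i =
     {c \<in> carrier (cech_module R M ys i). cech_diff R M ys i c = \<zero>\<^bsub>cech_module R M ys (Suc i)\<^esub>}"

definition cech_coboundaries ::
  "('a, 'm) ring_scheme \<Rightarrow> ('a, 'b, 'n) module_scheme \<Rightarrow> 'a list \<Rightarrow> nat \<Rightarrow>
     (nat set \<Rightarrow> ('b \<times> nat) set) set" where
  "cech_coboundaries R M ys i =
     (case i of 0 \<Rightarrow> {\<zero>\<^bsub>cech_module R M ys 0\<^esub>}
      | Suc j \<Rightarrow> cech_diff R M ys j ` carrier (cech_module R M ys j))"

definition local_cohomology ::
  "('a, 'm) ring_scheme \<Rightarrow> ('a, 'b, 'n) module_scheme \<Rightarrow> 'a list \<Rightarrow> nat \<Rightarrow>
     (nat set \<Rightarrow> ('b \<times> nat) set) set set" where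
  "local_cohomology R M ys i =
     (\<lambda>c. cech_coboundaries R M ys i +>\<^bsub>cech_module R M ys i\<^esub> c) ` cech_cocycles R M ys i"

text \<open>The part of degree \<open>n\<close>, for elements \<open>ys\<close> of degree \<open>1\<close>, so that \<open>y\<^sub>J\<close> has degree
  \<open>card J\<close>. The zero class is the coset \<open>cech_coboundaries\<close>.\<close>

definition local_cohomology_degree ::
  "('a, 'm) ring_scheme \<Rightarrow> ('a, 'b, 'n) module_scheme \<Rightarrow> (int \<Rightarrow> 'b set) \<Rightarrow> 'a list \<Rightarrow> nat \<Rightarrow> int \<Rightarrow>
     (nat set \<Rightarrow> ('b \<times> nat) set) set set" where
  "local_cohomology_degree R M D ys i n =
     (\<lambda>c. cech_coboundaries R M ys i +>\<^bsub>cech_module R M ys i\<^esub> c) `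
       {c \<in> cech_cocycles R M ys i.
          \<forall>J\<in>cech_index ys i. c J \<in> loc_degree R M D (cech_elem R ys J) (card J) n}"

definition a_invariant ::
  "('a, 'm) ring_scheme \<Rightarrow> ('a, 'b, 'n) module_scheme \<Rightarrow> (int \<Rightarrow> 'b set) \<Rightarrow> 'a list \<Rightarrow> nat \<Rightarrow> ereal" where
  "a_invariant R M D ys i =
     (if local_cohomology R M ys i \<noteq> {cech_coboundaries R M ys i}
      then Sup {ereal (real_of_int n) |n.
             local_cohomology_degree R M D ys i n \<noteq> {cech_coboundaries R M ys i}}
      else -\<infinity>)"

definition ideal_grading ::
  "('a, 'm) ring_scheme \<Rightarrow> (nat \<Rightarrow> 'a set) \<Rightarrow> 'a set \<Rightarrow> int \<Rightarrow> 'a set" where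
  "ideal_grading R G J k = (if k < 0 then {\<zero>\<^bsub>R\<^esub>} else J \<inter> G (nat k))"

text \<open>The generators of \<open>R\<^sub>+\<close> used for the Cech complex; local cohomology does not depend on the
  choice, and such lists exist because \<open>R = R\<^sub>0[R\<^sub>1]\<close> is finitely generated over \<open>R\<^sub>0\<close>.\<close>

definition degree_one_generators ::
  "('a, 'm) ring_scheme \<Rightarrow> (nat \<Rightarrow> 'a set) \<Rightarrow> 'a list \<Rightarrow> bool" where
  "degree_one_generators R G ys \<longleftrightarrow>
     set ys \<subseteq> G 1 \<and> genideal R (set ys) = irrelevant_ideal R G"

end

theory Submission
  imports Defs
begin

text \<open>Write \<open>N = I\<^bsub>\<lceil>n/p\<rceil>\<^esub>\<close> and \<open>M = I\<^bsub>n\<^esub>\<close>. Since \<open>a\<^sup>p \<in> M\<close> for \<open>a \<in> N\<close> and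
  \<open>\<phi>(f\<^sup>1\<^sup>/\<^sup>p) \<in> N\<close> for \<open>f \<in> M\<close>, the map \<open>\<phi>\<close> splits the inclusion \<open>N \<rightarrow> M\<^sup>1\<^sup>/\<^sup>p\<close>, and both parts follow
  from this case by induction on \<open>e\<close>. For the depth, the \<open>p\<close>-th powers of an \<open>M\<close>-regular sequence are
  again weakly \<open>M\<close>-regular, so the sequence is weakly regular on \<open>M\<^sup>1\<^sup>/\<^sup>p\<close> and on its direct summand
  \<open>N\<close>. For the \<open>a\<close>-invariants, taking \<open>p\<close>-th powers of Cech cocycles multiplies degrees by \<open>p\<close>, and
  \<open>\<phi>\<close> shows that it is injective on cohomology.\<close>

text \<open>The ceiling fits the filtration from both sides. For
  \<open>c = \<lceil>n/p\<rceil>\<close>, the bound \<open>n \<le> p c\<close> places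
  \<open>p\<close>-th powers of elements of \<open>I c\<close> in
  \<open>I (p c) \<subseteq> I n\<close>; for \<open>c > 0\<close>, the bound
  \<open>n \<ge> (c - 1) p + 1\<close> places \<open>I n\<close> in the ideal whose roots the
  filtration condition sends into \<open>I c\<close>. Being a direct summand does not settle the
  depth by itself: a regular sequence must also satisfy \<open>(xs) M \<noteq> M\<close>, and the
  depth is infinite as soon as \<open>\<mm> M = M\<close>. Therefore only weak regularity is
  transferred, and \<open>\<mm> M = M\<close> is compared with \<open>\<mm> N = N\<close>
  separately, which is where finitely many generators of \<open>\<mm>\<close> enter. For cohomology,
  all components of a cochain are written over one denominator exponent divisible by
  \<open>p\<close>. The coefficients of the differential on numerators, signs included, are then
  \<open>p\<close>-th powers that can be pulled out of \<open>\<phi>\<close>, so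
  \<open>\<phi>\<close> carries a primitive of the \<open>p\<close>-th power of a cocycle to a
  primitive of the cocycle.\<close>

section \<open>Additivity of the Frobenius\<close>

lemma (in cring) binomial_sum:
  assumes "a \<in> carrier R" and "b \<in> carrier R"
  shows "(a \<oplus> b) [^] (n::nat)
    = (\<Oplus>k\<in>{..n}. add_pow R (n choose k) (a [^] k \<otimes> b [^] (n - k)))"
proof (induction n)
  case 0
  then show ?case using assms by simp
next
  case (Suc n)
  define t where "t m k = add_pow R (m choose k) (a [^] k \<otimes> b [^] (m - k))" for m k :: nat
  \<comment> \<open>The exponent \<open>Suc n - k\<close> makes Pascal's rule \<open>split\<close>
    hold for every \<open>k\<close>. For \<open>k \<le> n\<close> the value is
    \<open>b \<otimes> t n k\<close>, and at \<open>k = Suc n\<close> it vanishes with the binomial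
    coefficient.\<close>
  define u where "u k = add_pow R (n choose k) (a [^] k \<otimes> b [^] (Suc n - k))" for k :: nat
  have tc: "t m k \<in> carrier R" "u k \<in> carrier R" for m k
    using assms by (simp_all add: t_def u_def)
  have split: "t (Suc n) (Suc k) = a \<otimes> t n k \<oplus> u (Suc k)" for k
    using assms by (simp add: t_def u_def add.nat_pow_mult[symmetric] add_pow_rdistr m_ac)
  have ub: "u k = b \<otimes> t n k" if "k \<le> n" for k
    using assms that by (simp add: t_def u_def Suc_diff_le add_pow_rdistr m_ac)
  have "finsum R (t (Suc n)) {..Suc n} = (\<Oplus>k\<in>{..n}. t (Suc n) (Suc k)) \<oplus> t (Suc n) 0"
    by (rule finsum_Suc2) (use tc in auto)
  also have "(\<Oplus>k\<in>{..n}. t (Suc n) (Suc k))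
      = (\<Oplus>k\<in>{..n}. a \<otimes> t n k) \<oplus> (\<Oplus>k\<in>{..n}. u (Suc k))"
    unfolding split by (rule finsum_addf) (use tc assms in auto)
  also have "t (Suc n) 0 = u 0"
    by (simp add: t_def u_def)
  also have "(\<Oplus>k\<in>{..n}. a \<otimes> t n k) \<oplus> (\<Oplus>k\<in>{..n}. u (Suc k)) \<oplus> u 0
      = (\<Oplus>k\<in>{..n}. a \<otimes> t n k) \<oplus> ((\<Oplus>k\<in>{..n}. u (Suc k)) \<oplus> u 0)"
    by (rule a_assoc) (use tc assms in \<open>auto intro!: finsum_closed\<close>)
  also have "(\<Oplus>k\<in>{..n}. u (Suc k)) \<oplus> u 0 = finsum R u {..Suc n}"
    by (rule finsum_Suc2[symmetric]) (use tc in auto)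
  also have "\<dots> = u (Suc n) \<oplus> finsum R u {..n}"
    by (rule finsum_Suc) (use tc in auto)
  also have "u (Suc n) = \<zero>"
    using assms by (simp add: u_def binomial_eq_0)
  also have "\<zero> \<oplus> finsum R u {..n} = finsum R u {..n}"
    by (rule l_zero) (use tc in \<open>auto intro!: finsum_closed\<close>)
  also have "finsum R u {..n} = (\<Oplus>k\<in>{..n}. b \<otimes> t n k)"
    by (rule finsum_cong') (use tc ub assms in auto)
  also have "(\<Oplus>k\<in>{..n}. b \<otimes> t n k) = b \<otimes> finsum R (t n) {..n}"
    by (rule finsum_rdistr[symmetric]) (use tc assms in auto)
  also have "(\<Oplus>k\<in>{..n}. a \<otimes> t n k) = a \<otimes> finsum R (t n) {..n}"
    by (rule finsum_rdistr[symmetric]) (use tc assms in auto)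
  also have "a \<otimes> finsum R (t n) {..n} \<oplus> b \<otimes> finsum R (t n) {..n} = (a \<oplus> b) \<otimes> finsum R (t n) {..n}"
    by (rule l_distr[symmetric]) (use tc assms in \<open>auto intro!: finsum_closed\<close>)
  also have "\<dots> = (a \<oplus> b) [^] Suc n"
    using Suc assms by (simp add: t_def[abs_def] m_comm)
  finally show ?case
    by (simp add: t_def[abs_def])
qed

text \<open>The prime \<open>p\<close> divides every binomial coefficient strictly between the two
  ends, and \<open>p\<close>-fold sums vanish because that of \<open>\<one>\<close> does.\<close>

lemma (in cring) frobenius_add:
  assumes "char_p p R" and a: "a \<in> carrier R" and b: "b \<in> carrier R"
  shows "(a \<oplus> b) [^] p = a [^] p \<oplus> b [^] p"
proof -
  have p: "Factorial_Ring.prime p" and z: "add_pow R p \<one> = \<zero>"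
    using assms(1) by (auto simp: char_p_def)
  have van: "add_pow R (p choose k) x = \<zero>" if "0 < k" "k < p" and x: "x \<in> carrier R" for k x
  proof -
    have "p dvd p choose k"
      using dvd_choose_prime[of k p] p that by simp
    then obtain q where q: "p choose k = p * q" by blast
    have "add_pow R p x = add_pow R p \<one> \<otimes> x"
      using x by (simp add: add_pow_ldistr)
    then have "add_pow R p x = \<zero>"
      using z x by simp
    then have "add_pow R q (add_pow R p x) = \<zero>"
      by simp
    then show ?thesis
      using x q by (simp add: add.nat_pow_pow)
  qed
  let ?t = "\<lambda>k. add_pow R (p choose k) (a [^] k \<otimes> b [^] (p - k))"
  \<comment> \<open>With \<open>m = p - 1\<close> and \<open>l = p - 2\<close> the two end terms can
    be split off, and the indices \<open>1, ..., p - 1\<close> remain.\<close>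
  obtain m where m: "p = Suc m"
    using p by (cases p) auto
  have m0: "m > 0" using p m by (cases m) auto
  obtain l where l: "m = Suc l" using m0 by (cases m) auto
  have "(a \<oplus> b) [^] p = finsum R ?t {..Suc m}"
    using binomial_sum[OF a b, of p] by (simp only: m)
  also have "\<dots> = ?t (Suc m) \<oplus> finsum R ?t {..m}"
    by (rule finsum_Suc) (use a b in auto)
  also have "finsum R ?t {..m} = (\<Oplus>k\<in>{..l}. ?t (Suc k)) \<oplus> ?t 0"
    unfolding l by (rule finsum_Suc2) (use a b in auto)
  also have "(\<Oplus>k\<in>{..l}. ?t (Suc k)) = (\<Oplus>k\<in>{..l}. \<zero>)"
    using a b m l by (intro finsum_cong' van) auto
  also have "\<dots> = \<zero>"
    by simp
  finally show ?thesis
    using a b m by simp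
qed

section \<open>Products of ideals with sets\<close>

lemma ideal_module_simps [simp]:
  "carrier (ideal_module R J) = J"
  "\<zero>\<^bsub>ideal_module R J\<^esub> = \<zero>\<^bsub>R\<^esub>"
  "x \<oplus>\<^bsub>ideal_module R J\<^esub> y = x \<oplus>\<^bsub>R\<^esub> y"
  "x \<odot>\<^bsub>ideal_module R J\<^esub> y = x \<otimes>\<^bsub>R\<^esub> y"
  by (simp_all add: ideal_module_def)

text \<open>This is \<open>K + x J\<close>: replacing \<open>K\<close> by it divides
  \<open>J / K\<close> by one more element of a sequence.\<close>

definition add_smult :: "('a, 'm) ring_scheme \<Rightarrow> 'a set \<Rightarrow> 'a \<Rightarrow> 'a set \<Rightarrow> 'a set" where
  "add_smult R K x J = {k \<oplus>\<^bsub>R\<^esub> x \<otimes>\<^bsub>R\<^esub> z |k z. k \<in> K \<and> z \<in> J}"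

context cring
begin

lemma ideal_facts:
  assumes "ideal J R"
  shows "x \<in> J \<Longrightarrow> x \<in> carrier R" "\<zero> \<in> J" "x \<in> J \<Longrightarrow> y \<in> J \<Longrightarrow> x \<oplus> y \<in> J"
    "x \<in> J \<Longrightarrow> \<ominus> x \<in> J" "x \<in> J \<Longrightarrow> y \<in> J \<Longrightarrow> x \<ominus> y \<in> J"
    "a \<in> carrier R \<Longrightarrow> x \<in> J \<Longrightarrow> a \<otimes> x \<in> J"
proof -
  interpret J: ideal J R by (rule assms)
  show "x \<in> J \<Longrightarrow> x \<in> carrier R" "\<zero> \<in> J" "x \<in> J \<Longrightarrow> y \<in> J \<Longrightarrow> x \<oplus> y \<in> J"
    "x \<in> J \<Longrightarrow> \<ominus> x \<in> J" "x \<in> J \<Longrightarrow> y \<in> J \<Longrightarrow> x \<ominus> y \<in> J"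
    "a \<in> carrier R \<Longrightarrow> x \<in> J \<Longrightarrow> a \<otimes> x \<in> J"
    by (auto simp: J.I_l_closed a_minus_def)
qed

lemma idealI':
  assumes "J \<subseteq> carrier R" "\<zero> \<in> J" "\<And>x y. x \<in> J \<Longrightarrow> y \<in> J \<Longrightarrow> x \<oplus> y \<in> J"
    and "\<And>a x. a \<in> carrier R \<Longrightarrow> x \<in> J \<Longrightarrow> a \<otimes> x \<in> J"
  shows "ideal J R"
proof (rule idealI)
  show "ring R" by (rule ring_axioms)
  have "\<ominus> x \<in> J" if "x \<in> J" for x
    using assms(4)[of "\<ominus> \<one>" x] assms(1) that by (auto simp: l_minus)
  then show "subgroup J (add_monoid R)"
    using assms by (intro subgroup.intro) (auto simp: a_inv_def)
  show "\<And>a x. a \<in> J \<Longrightarrow> x \<in> carrier R \<Longrightarrow> x \<otimes> a \<in> J"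
    using assms by auto
  show "\<And>a x. a \<in> J \<Longrightarrow> x \<in> carrier R \<Longrightarrow> a \<otimes> x \<in> J"
    using assms m_comm by (metis subsetD)
qed

text \<open>By this, \<open>mod_span\<close> over \<open>ideal_module R J\<close> becomes an
  intersection of ideals of \<open>R\<close>.\<close>

lemma submodule_ideal_module_iff:
  assumes J: "ideal J R"
  shows "submodule N R (ideal_module R J) \<longleftrightarrow> ideal N R \<and> N \<subseteq> J"
proof
  assume "submodule N R (ideal_module R J)"
  then interpret N: submodule N R "ideal_module R J" .
  have NJ: "N \<subseteq> J" using N.subset by simp
  moreover have "ideal N R"
    using NJ ideal_facts(1)[OF J] N.one_closed N.m_closed N.smult_closed
    by (intro idealI') auto
  ultimately show "ideal N R \<and> N \<subseteq> J" by simp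
next
  assume N: "ideal N R \<and> N \<subseteq> J"
  note J' = ideal_facts[OF J] and N' = ideal_facts[OF N[THEN conjunct1]]
  \<comment> \<open>The inverse in \<open>ideal_module R J\<close> is a description ranging over
    \<open>J\<close> only; it agrees with the inverse of \<open>R\<close> because \<open>J\<close>
    is closed under negation.\<close>
  have inv: "inv\<^bsub>add_monoid (ideal_module R J)\<^esub> x = \<ominus> x" if "x \<in> J" for x
    unfolding m_inv_def
    using that J' by (intro the_equality) (auto simp: l_neg r_neg minus_equality)
  show "submodule N R (ideal_module R J)"
    unfolding submodule_def submodule_axioms_def subgroup_def
    using N N' inv by auto
qed

lemma ideal_mult_alt:
  assumes "ideal J R"
  shows "ideal_mult R S (ideal_module R J)
    = \<Inter>{N. ideal N R \<and> N \<subseteq> J \<and> (\<forall>a\<in>S. \<forall>z\<in>J. a \<otimes> z \<in> N)}"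
  unfolding ideal_mult_def mod_span_def submodule_ideal_module_iff[OF assms]
  by (rule arg_cong[where f = Inter]) auto

lemma ideal_mult_props:
  assumes J: "ideal J R" and S: "S \<subseteq> carrier R"
  shows "ideal (ideal_mult R S (ideal_module R J)) R"
    "ideal_mult R S (ideal_module R J) \<subseteq> J"
    "a \<in> S \<Longrightarrow> z \<in> J \<Longrightarrow> a \<otimes> z \<in> ideal_mult R S (ideal_module R J)"
proof -
  let ?F = "{N. ideal N R \<and> N \<subseteq> J \<and> (\<forall>a\<in>S. \<forall>z\<in>J. a \<otimes> z \<in> N)}"
  have "J \<in> ?F" using J S ideal_facts[OF J] by auto
  then show "ideal (ideal_mult R S (ideal_module R J)) R"
    unfolding ideal_mult_alt[OF J] by (intro i_Intersect) auto
  show "ideal_mult R S (ideal_module R J) \<subseteq> J"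
    unfolding ideal_mult_alt[OF J] using \<open>J \<in> ?F\<close> by (rule Inter_lower)
  show "a \<in> S \<Longrightarrow> z \<in> J \<Longrightarrow> a \<otimes> z \<in> ideal_mult R S (ideal_module R J)"
    unfolding ideal_mult_alt[OF J] by blast
qed

lemma ideal_mult_least:
  assumes "ideal J R" "ideal N R" "N \<subseteq> J" "\<And>a z. a \<in> S \<Longrightarrow> z \<in> J \<Longrightarrow> a \<otimes> z \<in> N"
  shows "ideal_mult R S (ideal_module R J) \<subseteq> N"
  unfolding ideal_mult_alt[OF assms(1)] using assms by blast

lemma ideal_mult_mono:
  assumes "ideal J R" "S \<subseteq> T" "T \<subseteq> carrier R"
  shows "ideal_mult R S (ideal_module R J) \<subseteq> ideal_mult R T (ideal_module R J)"
  using assms by (intro ideal_mult_least ideal_mult_props) auto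

lemma ideal_mult_empty:
  assumes "ideal J R"
  shows "ideal_mult R {} (ideal_module R J) = {\<zero>}"
proof
  show "ideal_mult R {} (ideal_module R J) \<subseteq> {\<zero>}"
    using assms ideal_facts[OF assms] by (intro ideal_mult_least zeroideal) auto
  show "{\<zero>} \<subseteq> ideal_mult R {} (ideal_module R J)"
    using ideal_facts(2)[OF ideal_mult_props(1)[OF assms]] by simp
qed

lemma mem_add_smult:
  "y \<in> add_smult R K x J \<longleftrightarrow> (\<exists>k\<in>K. \<exists>z\<in>J. y = k \<oplus> x \<otimes> z)"
  by (auto simp: add_smult_def)

lemma ideal_add_smult:
  assumes K: "ideal K R" and J: "ideal J R" and x: "x \<in> carrier R"
  shows "ideal (add_smult R K x J) R"
proof (rule idealI')
  note Kf = ideal_facts[OF K] and Jf = ideal_facts[OF J]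
  show "add_smult R K x J \<subseteq> carrier R"
    using x Kf(1) Jf(1) by (auto simp: mem_add_smult)
  have "\<zero> = \<zero> \<oplus> x \<otimes> \<zero>" using x by simp
  then show "\<zero> \<in> add_smult R K x J"
    unfolding mem_add_smult using Kf(2) Jf(2) by blast
  show "u \<oplus> v \<in> add_smult R K x J" if prem: "u \<in> add_smult R K x J" "v \<in> add_smult R K x J" for u v
  proof -
    obtain k z l w where kz: "k \<in> K" "z \<in> J" "u = k \<oplus> x \<otimes> z" "l \<in> K" "w \<in> J" "v = l \<oplus> x \<otimes> w"
      using prem unfolding mem_add_smult by blast
    then have "u \<oplus> v = (k \<oplus> l) \<oplus> x \<otimes> (z \<oplus> w)"
      using x Kf(1) Jf(1) by (simp add: r_distr a_ac)
    then show ?thesis unfolding mem_add_smult using kz Kf(3) Jf(3) by blast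
  qed
  show "a \<otimes> u \<in> add_smult R K x J" if prem: "a \<in> carrier R" "u \<in> add_smult R K x J" for a u
  proof -
    obtain k z where kz: "k \<in> K" "z \<in> J" "u = k \<oplus> x \<otimes> z"
      using prem unfolding mem_add_smult by blast
    then have "a \<otimes> u = a \<otimes> k \<oplus> x \<otimes> (a \<otimes> z)"
      using prem(1) x Kf(1) Jf(1) by (simp add: r_distr m_lcomm)
    then show ?thesis unfolding mem_add_smult using kz prem(1) Kf(6) Jf(6) by blast
  qed
qed

lemma add_smult_subset:
  assumes "ideal J R" "K \<subseteq> J" "x \<in> carrier R"
  shows "add_smult R K x J \<subseteq> J"
  using assms by (auto simp: mem_add_smult intro!: ideal_facts(3,6)[OF assms(1)])

lemma subset_add_smult:
  assumes "ideal J R" "ideal K R" "x \<in> carrier R"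
  shows "K \<subseteq> add_smult R K x J"
proof
  fix k assume k: "k \<in> K"
  have "k = k \<oplus> x \<otimes> \<zero>"
    using k assms ideal_facts(1)[OF assms(2)] by simp
  then show "k \<in> add_smult R K x J"
    unfolding mem_add_smult using k ideal_facts(2)[OF assms(1)] by blast
qed

lemma mult_mem_add_smult:
  assumes "ideal J R" "ideal K R" "x \<in> carrier R" "z \<in> J"
  shows "x \<otimes> z \<in> add_smult R K x J"
proof -
  have "x \<otimes> z = \<zero> \<oplus> x \<otimes> z"
    using assms ideal_facts(1)[OF assms(1)] by simp
  then show ?thesis
    unfolding mem_add_smult using assms ideal_facts(2)[OF assms(2)] by blast
qed

text \<open>This replaces the intersection behind \<open>ideal_mult\<close> by explicit sums, one
  generator at a time, as inductions over sequences and finite generating sets require.\<close>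

lemma ideal_mult_insert:
  assumes J: "ideal J R" and S: "S \<subseteq> carrier R" and x: "x \<in> carrier R"
  shows "ideal_mult R (insert x S) (ideal_module R J)
    = add_smult R (ideal_mult R S (ideal_module R J)) x J"
proof
  let ?L = "ideal_mult R (insert x S) (ideal_module R J)"
  let ?K = "ideal_mult R S (ideal_module R J)"
  note K = ideal_mult_props[OF J S]
  have xS: "insert x S \<subseteq> carrier R" using S x by simp
  note L = ideal_mult_props[OF J xS]
  show "?L \<subseteq> add_smult R ?K x J"
    using mult_mem_add_smult[OF J K(1) x] subset_add_smult[OF J K(1) x]
    by (intro ideal_mult_least J ideal_add_smult add_smult_subset K x) (auto intro: K)
  have "?K \<subseteq> ?L" using xS by (intro ideal_mult_mono J) auto
  then show "add_smult R ?K x J \<subseteq> ?L"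
    using L(3)[of x] by (auto simp: mem_add_smult intro!: ideal_facts(3)[OF L(1)])
qed

text \<open>The elements \<open>a\<close> with \<open>a J \<subseteq> S J\<close> form an ideal that
  contains \<open>S\<close>. Through this lemma an infinite set such as \<open>\<mm>\<close> is
  replaced by finitely many generators.\<close>

lemma ideal_mult_genideal:
  assumes J: "ideal J R" and S: "S \<subseteq> carrier R"
  shows "ideal_mult R (Idl S) (ideal_module R J) = ideal_mult R S (ideal_module R J)"
    (is "?L = ?K")
proof
  note K = ideal_mult_props[OF J S]
  note J' = ideal_facts[OF J] and K' = ideal_facts[OF K(1)]
  let ?A = "{a \<in> carrier R. \<forall>z\<in>J. a \<otimes> z \<in> ?K}"
  have "ideal ?A R"
    using J' K' by (intro idealI') (auto simp: l_distr m_assoc)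
  moreover have "S \<subseteq> ?A" using S K(3) by auto
  ultimately have "Idl S \<subseteq> ?A" by (rule genideal_minimal)
  then show "?L \<subseteq> ?K" by (intro ideal_mult_least J K(1,2)) auto
  show "?K \<subseteq> ?L"
    using genideal_self[OF S] genideal_ideal[OF S] J
    by (intro ideal_mult_mono) (auto intro: ideal_facts(1))
qed

text \<open>Substituting \<open>J = K + a J\<close> into itself gives
  \<open>J = K + a\<^sup>k J\<close> for all \<open>k\<close>, so one generator can be exchanged for
  its power. The set \<open>B\<close> collects the generators already exchanged.\<close>

lemma ideal_mult_pow_full:
  assumes J: "ideal J R" and "finite A" "A \<subseteq> carrier R" "B \<subseteq> carrier R"
    and "ideal_mult R (A \<union> B) (ideal_module R J) = J"
  shows "ideal_mult R ((\<lambda>s. s [^] (p::nat)) ` A \<union> B) (ideal_module R J) = J"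
  using assms(2-)
proof (induction A arbitrary: B rule: finite_induct)
  case empty
  then show ?case by simp
next
  case (insert a A)
  let ?K = "ideal_mult R (A \<union> B) (ideal_module R J)"
  have AB: "A \<union> B \<subseteq> carrier R" and a: "a \<in> carrier R" using insert by auto
  note K = ideal_mult_props[OF J AB]
  note J' = ideal_facts[OF J] and K' = ideal_facts[OF K(1)]
  have *: "J \<subseteq> add_smult R ?K a J"
    using insert.prems ideal_mult_insert[OF J AB a] by simp
  have "J \<subseteq> add_smult R ?K (a [^] k) J" for k :: nat
  proof (induction k)
    case 0
    show ?case
    proof
      fix z assume "z \<in> J"
      then have "z = \<zero> \<oplus> \<one> \<otimes> z" using J' by simp
      then show "z \<in> add_smult R ?K (a [^] (0::nat)) J"
        unfolding mem_add_smult using \<open>z \<in> J\<close> K'(2) by auto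
    qed
  next
    case (Suc k)
    show ?case
    proof
      fix z assume "z \<in> J"
      then obtain u w where u: "u \<in> ?K" "w \<in> J" "z = u \<oplus> a [^] k \<otimes> w"
        using Suc unfolding mem_add_smult[symmetric] by (meson mem_add_smult subsetD)
      then obtain u' w' where u': "u' \<in> ?K" "w' \<in> J" "w = u' \<oplus> a \<otimes> w'"
        using * by (meson mem_add_smult subsetD)
      have c: "u \<in> carrier R" "u' \<in> carrier R" "w' \<in> carrier R" using u u' K' J' by auto
      have "z = (u \<oplus> a [^] k \<otimes> u') \<oplus> a [^] Suc k \<otimes> w'"
        unfolding u(3) u'(3) using a c by (simp add: r_distr m_assoc a_assoc)
      moreover have "u \<oplus> a [^] k \<otimes> u' \<in> ?K" using u u' K' a by auto
      ultimately show "z \<in> add_smult R ?K (a [^] Suc k) J"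
        unfolding mem_add_smult using u'(2) by blast
    qed
  qed
  then have "add_smult R ?K (a [^] p) J = J"
    using add_smult_subset[OF J K(2)] a by blast
  then have "ideal_mult R (A \<union> insert (a [^] p) B) (ideal_module R J) = J"
    using ideal_mult_insert[OF J AB, of "a [^] p"] a by simp
  then have "ideal_mult R ((\<lambda>s. s [^] p) ` A \<union> insert (a [^] p) B) (ideal_module R J) = J"
    using insert a by (intro insert.IH) auto
  then show ?case by simp
qed

end

section \<open>Weakly regular sequences\<close>

text \<open>\<open>wreg R J K xs\<close> says that \<open>xs\<close> is weakly regular on the module \<open>J / K\<close>.\<close>

primrec wreg :: "('a, 'm) ring_scheme \<Rightarrow> 'a set \<Rightarrow> 'a set \<Rightarrow> 'a list \<Rightarrow> bool" where
  "wreg R J K [] \<longleftrightarrow> True"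
| "wreg R J K (x # xs) \<longleftrightarrow>
     (\<forall>z\<in>J. x \<otimes>\<^bsub>R\<^esub> z \<in> K \<longrightarrow> z \<in> K) \<and> wreg R J (add_smult R K x J) xs"

context cring
begin

text \<open>The set \<open>S\<close> is arbitrary because each step of the induction moves the head
  of the sequence into it.\<close>

lemma wreg_ideal_mult_iff:
  assumes J: "ideal J R" and "S \<subseteq> carrier R" "set xs \<subseteq> carrier R"
  shows "wreg R J (ideal_mult R S (ideal_module R J)) xs \<longleftrightarrow>
    (\<forall>i<length xs. \<forall>z\<in>J. xs ! i \<otimes> z \<in> ideal_mult R (S \<union> set (take i xs)) (ideal_module R J)
       \<longrightarrow> z \<in> ideal_mult R (S \<union> set (take i xs)) (ideal_module R J))"
  using assms(2,3)
proof (induction xs arbitrary: S)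
  case Nil
  then show ?case by simp
next
  case (Cons x xs)
  then have "add_smult R (ideal_mult R S (ideal_module R J)) x J
      = ideal_mult R (insert x S) (ideal_module R J)"
    using ideal_mult_insert[OF J, of S x] by simp
  then show ?case
    using Cons by (simp add: All_less_Suc2)
qed

lemma regular_seq_imp_wreg:
  assumes "ideal J R" "regular_seq R (ideal_module R J) xs"
  shows "wreg R J {\<zero>} xs"
  using wreg_ideal_mult_iff[OF assms(1), of "{}" xs] assms
  by (simp add: regular_seq_def ideal_mult_empty)

lemma wreg_imp_regular_seq:
  assumes "ideal J R" "wreg R J {\<zero>} xs" "set xs \<subseteq> carrier R"
    "ideal_mult R (set xs) (ideal_module R J) \<noteq> J"
  shows "regular_seq R (ideal_module R J) xs"
  using wreg_ideal_mult_iff[OF assms(1), of "{}" xs] assms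
  by (simp add: regular_seq_def ideal_mult_empty)

text \<open>The hypotheses on \<open>h\<close> say that it induces an isomorphism from \<open>J / K\<close> to \<open>J' / K'\<close>.\<close>

lemma wreg_iso:
  assumes J: "ideal J R" and J': "ideal J' R" and "ideal K R" "ideal K' R" "K \<subseteq> J" "K' \<subseteq> J'"
    and hc: "\<And>z. z \<in> J \<Longrightarrow> h z \<in> J'"
    and ha: "\<And>z w. z \<in> J \<Longrightarrow> w \<in> J \<Longrightarrow> h (z \<oplus> w) = h z \<oplus> h w"
    and hs: "\<And>a z. a \<in> carrier R \<Longrightarrow> z \<in> J \<Longrightarrow> h (a \<otimes> z) = a \<otimes> h z"
    and "\<And>z. z \<in> J \<Longrightarrow> h z \<in> K' \<longleftrightarrow> z \<in> K"
    and "\<And>z'. z' \<in> J' \<Longrightarrow> \<exists>k\<in>K'. \<exists>z\<in>J. z' = k \<oplus> h z"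
    and "set xs \<subseteq> carrier R" "wreg R J K xs"
  shows "wreg R J' K' xs"
  using assms(3-6,10-)
proof (induction xs arbitrary: K K')
  case Nil
  then show ?case by simp
next
  case (Cons x xs)
  note Jf = ideal_facts[OF J] and J'f = ideal_facts[OF J']
    and Kf = ideal_facts[OF Cons.prems(1)] and K'f = ideal_facts[OF Cons.prems(2)]
  have x: "x \<in> carrier R" and xs: "set xs \<subseteq> carrier R" using Cons.prems by auto
  note hK = Cons.prems(5) and sur = Cons.prems(6)
  have "z' \<in> K'" if z': "z' \<in> J'" "x \<otimes> z' \<in> K'" for z'
  proof -
    obtain k z where k: "k \<in> K'" "z \<in> J" "z' = k \<oplus> h z" using sur z' by blast
    have c: "k \<in> carrier R" "h z \<in> carrier R" using k K'f J'f hc by auto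
    have "h (x \<otimes> z) = x \<otimes> z' \<ominus> x \<otimes> k"
      using hs[OF x k(2)] k(3) c x by algebra
    then have "h (x \<otimes> z) \<in> K'" using z' k x K'f by auto
    then have "x \<otimes> z \<in> K" using hK x k Jf by auto
    then have "z \<in> K" using Cons.prems(8) k by auto
    then show ?thesis using hK k K'f by auto
  qed
  moreover have "wreg R J' (add_smult R K' x J') xs"
  proof (rule Cons.IH)
    show "ideal (add_smult R K x J) R" "ideal (add_smult R K' x J') R"
      by (intro ideal_add_smult J J' Cons.prems x)+
    show "add_smult R K x J \<subseteq> J" "add_smult R K' x J' \<subseteq> J'"
      by (intro add_smult_subset J J' Cons.prems x)+
    show "set xs \<subseteq> carrier R" by (rule xs)
    show "wreg R J (add_smult R K x J) xs" using Cons.prems by simp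
    show "\<exists>k\<in>add_smult R K' x J'. \<exists>z\<in>J. z' = k \<oplus> h z" if "z' \<in> J'" for z'
      using sur[OF that] subset_add_smult[OF J' Cons.prems(2) x] by blast
    show "h z \<in> add_smult R K' x J' \<longleftrightarrow> z \<in> add_smult R K x J" if z: "z \<in> J" for z
    proof
      assume "h z \<in> add_smult R K' x J'"
      then obtain k w' where k: "k \<in> K'" "w' \<in> J'" "h z = k \<oplus> x \<otimes> w'"
        unfolding mem_add_smult by blast
      \<comment> \<open>Lifting \<open>w'\<close> through \<open>h\<close> leaves an error
        \<open>l\<close> in \<open>K'\<close>, and \<open>x \<otimes> l\<close> is absorbed by
        \<open>K'\<close>; hence \<open>z \<ominus> x \<otimes> w\<close> lies in
        \<open>K\<close>.\<close>
      obtain l w where l: "l \<in> K'" "w \<in> J" "w' = l \<oplus> h w" using sur k by blast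
      have c: "k \<in> carrier R" "l \<in> carrier R" "h w \<in> carrier R" "w \<in> carrier R" "z \<in> carrier R"
        using k l K'f J'f hc Jf z by auto
      have "z \<ominus> x \<otimes> w = z \<oplus> (\<ominus> x) \<otimes> w" using c x by algebra
      then have "h (z \<ominus> x \<otimes> w) = h z \<oplus> (\<ominus> x) \<otimes> h w"
        using ha[of z "(\<ominus> x) \<otimes> w"] hs[of "\<ominus> x" w] x z l Jf by auto
      also have "\<dots> = k \<oplus> x \<otimes> l"
        using k l c x by algebra
      also have "\<dots> \<in> K'" using k l x K'f by auto
      finally have "z \<ominus> x \<otimes> w \<in> K" using hK[of "z \<ominus> x \<otimes> w"] z l x Jf by auto
      moreover have "z = (z \<ominus> x \<otimes> w) \<oplus> x \<otimes> w" using c x by algebra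
      ultimately show "z \<in> add_smult R K x J" unfolding mem_add_smult using l by blast
    next
      assume "z \<in> add_smult R K x J"
      then obtain k w where k: "k \<in> K" "w \<in> J" "z = k \<oplus> x \<otimes> w"
        unfolding mem_add_smult by blast
      have "k \<in> J" using k Cons.prems by auto
      then have "h z = h k \<oplus> x \<otimes> h w" "h k \<in> K'"
        using k ha[of k "x \<otimes> w"] hs[of x w] x Jf hK by auto
      then show "h z \<in> add_smult R K' x J'" unfolding mem_add_smult using k hc by blast
    qed
  qed
  ultimately show ?case by simp
qed

text \<open>The extension in question is \<open>0 \<rightarrow> L / K \<rightarrow> J / K \<rightarrow> J / L \<rightarrow> 0\<close>.\<close>

lemma wreg_extension:
  assumes J: "ideal J R" and "ideal L R" "ideal K R" "K \<subseteq> L" "L \<subseteq> J" "set xs \<subseteq> carrier R"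
    and "wreg R L K xs" "wreg R J L xs"
  shows "wreg R J K xs"
  using assms(2-)
proof (induction xs arbitrary: K L)
  case Nil
  then show ?case by simp
next
  case (Cons x xs)
  have L: "ideal L R" and K: "ideal K R" and KL: "K \<subseteq> L" and LJ: "L \<subseteq> J"
    and x: "x \<in> carrier R" and xs: "set xs \<subseteq> carrier R" using Cons.prems by auto
  note Jf = ideal_facts[OF J] and Lf = ideal_facts[OF L] and Kf = ideal_facts[OF K]
  have reg: "z \<in> L" if "z \<in> J" "x \<otimes> z \<in> L" for z using Cons.prems(7) that by auto
  have "z \<in> K" if "z \<in> J" "x \<otimes> z \<in> K" for z
    using that reg KL Cons.prems(6) by auto
  moreover have "wreg R J (add_smult R K x J) xs"
  proof (rule Cons.IH)
    show L1: "ideal (add_smult R L x J) R" and K1: "ideal (add_smult R K x J) R"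
      by (intro ideal_add_smult L K J x)+
    show KL1: "add_smult R K x J \<subseteq> add_smult R L x J"
      using KL unfolding add_smult_def by blast
    show "add_smult R L x J \<subseteq> J" by (intro add_smult_subset J LJ x)
    show "set xs \<subseteq> carrier R" by (rule xs)
    show "wreg R J (add_smult R L x J) xs" using Cons.prems by simp
    \<comment> \<open>Regularity of \<open>x\<close> on \<open>J / L\<close> gives
      \<open>L \<inter> (K + x J) = K + x L\<close>. Hence the inclusion of \<open>L\<close>
      identifies \<open>L / (K + x L)\<close> with \<open>(L + x J) / (K + x J)\<close>, the
      submodule of the extension after division by \<open>x\<close>.\<close>
    show "wreg R (add_smult R L x J) (add_smult R K x J) xs"
    proof (rule wreg_iso[where h = "\<lambda>z. z" and J = L and K = "add_smult R K x L"])
      show "ideal L R" "ideal (add_smult R L x J) R" "ideal (add_smult R K x L) R" "ideal (add_smult R K x J) R"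
        by (intro L L1 K1 ideal_add_smult K x)+
      show "add_smult R K x L \<subseteq> L" by (intro add_smult_subset L KL x)
      show "add_smult R K x J \<subseteq> add_smult R L x J" by (rule KL1)
      show "z \<in> add_smult R L x J" if "z \<in> L" for z
        using that subset_add_smult[OF J L x] by auto
      show "wreg R L (add_smult R K x L) xs" using Cons.prems by simp
      show "z \<in> add_smult R K x J \<longleftrightarrow> z \<in> add_smult R K x L" if z: "z \<in> L" for z
      proof
        assume "z \<in> add_smult R K x J"
        then obtain k w where k: "k \<in> K" "w \<in> J" "z = k \<oplus> x \<otimes> w" unfolding mem_add_smult by blast
        have "x \<otimes> w = z \<ominus> k" using k x Kf Jf Lf z by algebra
        moreover have "z \<ominus> k \<in> L" using z k(1) KL Lf(5) by blast
        ultimately have "x \<otimes> w \<in> L" by simp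
        then have "w \<in> L" using reg k by auto
        then show "z \<in> add_smult R K x L" unfolding mem_add_smult using k by blast
      next
        assume "z \<in> add_smult R K x L"
        then show "z \<in> add_smult R K x J" unfolding mem_add_smult using LJ by blast
      qed
      show "\<exists>k\<in>add_smult R K x J. \<exists>z\<in>L. z' = k \<oplus> z" if z': "z' \<in> add_smult R L x J" for z'
      proof -
        obtain l w where l: "l \<in> L" "w \<in> J" "z' = l \<oplus> x \<otimes> w"
          using z' unfolding mem_add_smult by blast
        then have "z' = x \<otimes> w \<oplus> l" using x Lf Jf a_comm by auto
        then show ?thesis using mult_mem_add_smult[OF J K x l(2)] l by blast
      qed
    qed (use xs in auto)
  qed
  ultimately show ?case by simp
qed

text \<open>The module \<open>J / (K + a b J)\<close> is an extension of
  \<open>J / (K + a J)\<close> by \<open>(K + a J) / (K + a b J)\<close>. Multiplication by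
  \<open>a\<close> identifies \<open>J / (K + b J)\<close> with the latter, because \<open>a\<close>
  can be cancelled modulo \<open>K\<close>, so \<open>xs\<close> is weakly regular on both
  ends.\<close>

lemma wreg_mult:
  assumes J: "ideal J R" and K: "ideal K R" and KJ: "K \<subseteq> J"
    and a: "a \<in> carrier R" and b: "b \<in> carrier R" and xs: "set xs \<subseteq> carrier R"
    and wa: "wreg R J K (a # xs)" and wb: "wreg R J K (b # xs)"
  shows "wreg R J K (a \<otimes> b # xs)"
proof -
  note Jf = ideal_facts[OF J] and Kf = ideal_facts[OF K]
  have ra: "z \<in> K" if "z \<in> J" "a \<otimes> z \<in> K" for z using wa that by auto
  have rb: "z \<in> K" if "z \<in> J" "b \<otimes> z \<in> K" for z using wb that by auto
  have ab: "a \<otimes> b \<in> carrier R" using a b by simp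
  have ass: "a \<otimes> b \<otimes> z = a \<otimes> (b \<otimes> z)" if "z \<in> J" for z using a b that Jf by (simp add: m_assoc)
  have "z \<in> K" if z: "z \<in> J" "a \<otimes> b \<otimes> z \<in> K" for z
  proof (rule rb[OF z(1)], rule ra)
    show "b \<otimes> z \<in> J" using b z Jf by auto
    show "a \<otimes> (b \<otimes> z) \<in> K" using ass z by simp
  qed
  moreover have "wreg R J (add_smult R K (a \<otimes> b) J) xs"
  proof (rule wreg_extension[OF J, where L = "add_smult R K a J"])
    show La: "ideal (add_smult R K a J) R" and Kab: "ideal (add_smult R K (a \<otimes> b) J) R"
      by (intro ideal_add_smult J K a ab)+
    show sub: "add_smult R K (a \<otimes> b) J \<subseteq> add_smult R K a J"
    proof
      fix y assume "y \<in> add_smult R K (a \<otimes> b) J"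
      then obtain k z where k: "k \<in> K" "z \<in> J" "y = k \<oplus> a \<otimes> b \<otimes> z" unfolding mem_add_smult by blast
      then have "y = k \<oplus> a \<otimes> (b \<otimes> z)" "b \<otimes> z \<in> J" using ass b Jf by auto
      then show "y \<in> add_smult R K a J" unfolding mem_add_smult using k by blast
    qed
    show "add_smult R K a J \<subseteq> J" by (intro add_smult_subset J KJ a)
    show "set xs \<subseteq> carrier R" by (rule xs)
    show "wreg R J (add_smult R K a J) xs" using wa by simp
    show "wreg R (add_smult R K a J) (add_smult R K (a \<otimes> b) J) xs"
    proof (rule wreg_iso[where h = "\<lambda>z. a \<otimes> z" and J = J and K = "add_smult R K b J"])
      show "ideal J R" "ideal (add_smult R K a J) R" "ideal (add_smult R K b J) R"
        "ideal (add_smult R K (a \<otimes> b) J) R"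
        by (intro J La Kab ideal_add_smult K b)+
      show "add_smult R K b J \<subseteq> J" by (intro add_smult_subset J KJ b)
      show "add_smult R K (a \<otimes> b) J \<subseteq> add_smult R K a J" by (rule sub)
      show "wreg R J (add_smult R K b J) xs" using wb by simp
      show "a \<otimes> z \<in> add_smult R K a J" if "z \<in> J" for z
        by (rule mult_mem_add_smult[OF J K a that])
      show "a \<otimes> (z \<oplus> w) = a \<otimes> z \<oplus> a \<otimes> w" if "z \<in> J" "w \<in> J" for z w
        using that a Jf by (simp add: r_distr)
      show "a \<otimes> (c \<otimes> z) = c \<otimes> (a \<otimes> z)" if "c \<in> carrier R" "z \<in> J" for c z
        using that a Jf by (simp add: m_lcomm)
      show "a \<otimes> z \<in> add_smult R K (a \<otimes> b) J \<longleftrightarrow> z \<in> add_smult R K b J" if z: "z \<in> J" for z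
      proof
        assume "a \<otimes> z \<in> add_smult R K (a \<otimes> b) J"
        then obtain k w where k: "k \<in> K" "w \<in> J" "a \<otimes> z = k \<oplus> a \<otimes> b \<otimes> w"
          unfolding mem_add_smult by blast
        have c: "z \<in> carrier R" "k \<in> carrier R" "w \<in> carrier R" using z k Jf Kf by auto
        have "a \<otimes> (z \<ominus> b \<otimes> w) = a \<otimes> z \<ominus> a \<otimes> b \<otimes> w" using c a b by algebra
        also have "\<dots> = k" unfolding k(3) using c a b by algebra
        finally have "z \<ominus> b \<otimes> w \<in> K" using ra k z b Jf by auto
        moreover have "z = (z \<ominus> b \<otimes> w) \<oplus> b \<otimes> w" using c b by algebra
        ultimately show "z \<in> add_smult R K b J" unfolding mem_add_smult using k by blast
      next
        assume "z \<in> add_smult R K b J"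
        then obtain k w where k: "k \<in> K" "w \<in> J" "z = k \<oplus> b \<otimes> w"
          unfolding mem_add_smult by blast
        have "a \<otimes> z = a \<otimes> k \<oplus> a \<otimes> b \<otimes> w" "a \<otimes> k \<in> K"
          using k a b Jf Kf by (auto simp: r_distr m_assoc)
        then show "a \<otimes> z \<in> add_smult R K (a \<otimes> b) J" unfolding mem_add_smult using k by blast
      qed
      show "\<exists>k\<in>add_smult R K (a \<otimes> b) J. \<exists>z\<in>J. z' = k \<oplus> a \<otimes> z" if "z' \<in> add_smult R K a J" for z'
        using that subset_add_smult[OF J K ab] unfolding mem_add_smult by blast
    qed (use xs in auto)
  qed
  ultimately show ?thesis by simp
qed

lemma wreg_pow:
  assumes "ideal J R" "ideal K R" "K \<subseteq> J" "x \<in> carrier R" "set xs \<subseteq> carrier R"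
    and "wreg R J K (x # xs)"
  shows "wreg R J K (x [^] Suc k # xs)"
proof (induction k)
  case 0
  then show ?case using assms by simp
next
  case (Suc k)
  show ?case
    unfolding nat_pow_Suc[of x "Suc k"]
    by (rule wreg_mult[OF assms(1-3) nat_pow_closed[OF assms(4)] assms(4,5) Suc assms(6)])
qed

text \<open>Since \<open>wreg_pow\<close> changes the head and keeps the tail, the sequence is
  treated from the front: the tail is weakly regular modulo \<open>K + x\<^sup>n J\<close>, where
  the induction hypothesis applies.\<close>

lemma wreg_map_pow:
  assumes J: "ideal J R" and "ideal K R" "K \<subseteq> J" "set xs \<subseteq> carrier R" "wreg R J K xs" "0 < n"
  shows "wreg R J K (map (\<lambda>x. x [^] (n::nat)) xs)"
  using assms(2-5)
proof (induction xs arbitrary: K)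
  case Nil
  then show ?case by simp
next
  case (Cons x xs)
  have x: "x \<in> carrier R" using Cons.prems by simp
  have "wreg R J K (x [^] n # xs)"
    using wreg_pow[of J K x xs "n - 1"] Cons.prems J \<open>0 < n\<close> by simp
  moreover have "ideal (add_smult R K (x [^] n) J) R" "add_smult R K (x [^] n) J \<subseteq> J"
    by (intro ideal_add_smult add_smult_subset J Cons.prems nat_pow_closed x)+
  ultimately show ?case
    using Cons.IH[of "add_smult R K (x [^] n) J"] Cons.prems by simp
qed

end

section \<open>Splittings of the Frobenius\<close>

text \<open>Here \<open>\<phi>\<close> stands for
  \<open>f \<mapsto> \<phi>(f\<^sup>1\<^sup>/\<^sup>p)\<close> as a map of \<open>R\<close> to
  itself. The module \<open>M\<^sup>1\<^sup>/\<^sup>p\<close> thus becomes \<open>M\<close> with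
  \<open>a\<close> acting as \<open>a\<^sup>p\<close>, and being the identity on \<open>R\<close>
  becomes \<open>split_pow\<close>.\<close>

locale frobenius_splitting = cring +
  fixes p :: nat and \<phi> :: "'a \<Rightarrow> 'a"
  assumes char: "char_p p R"
    and split_closed [simp, intro]: "f \<in> carrier R \<Longrightarrow> \<phi> f \<in> carrier R"
    and split_add: "f \<in> carrier R \<Longrightarrow> g \<in> carrier R \<Longrightarrow> \<phi> (f \<oplus> g) = \<phi> f \<oplus> \<phi> g"
    and split_mult: "a \<in> carrier R \<Longrightarrow> f \<in> carrier R \<Longrightarrow> \<phi> (a [^] p \<otimes> f) = a \<otimes> \<phi> f"
    and split_pow: "a \<in> carrier R \<Longrightarrow> \<phi> (a [^] p) = a"
begin

lemma p_pos: "0 < p"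
  using char by (auto simp: char_p_def intro: prime_gt_0_nat)

lemmas frob_add = frobenius_add[OF char]

lemma zero_pow_p: "\<zero> [^] p = \<zero>"
  using p_pos by (simp add: nat_pow_zero)

lemma split_zero: "\<phi> \<zero> = \<zero>"
  using split_pow[of \<zero>] zero_pow_p by simp

text \<open>If \<open>x z \<in> L\<close>, then \<open>x\<^sup>p z\<^sup>p \<in> K\<close>, so
  \<open>z\<^sup>p \<in> K\<close> and \<open>z = \<phi>(z\<^sup>p) \<in> L\<close>. The conditions
  linking \<open>L\<close> and \<open>K\<close> repeat those linking \<open>N\<close> and
  \<open>M\<close>, and they survive the passage to \<open>L + x N\<close> and
  \<open>K + x\<^sup>p M\<close>.\<close>

lemma wreg_split:
  assumes M: "ideal M R" and N: "ideal N R"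
    and NM: "\<And>a. a \<in> N \<Longrightarrow> a [^] p \<in> M" and MN: "\<And>f. f \<in> M \<Longrightarrow> \<phi> f \<in> N"
    and "ideal K R" "ideal L R" "K \<subseteq> M" "L \<subseteq> N"
    and "\<And>a. a \<in> L \<Longrightarrow> a [^] p \<in> K" "\<And>f. f \<in> K \<Longrightarrow> \<phi> f \<in> L"
    and "set xs \<subseteq> carrier R" "wreg R M K (map (\<lambda>x. x [^] p) xs)"
  shows "wreg R N L xs"
  using assms(5-)
proof (induction xs arbitrary: K L)
  case Nil
  then show ?case by simp
next
  case (Cons x xs)
  note K = \<open>ideal K R\<close> and L = \<open>ideal L R\<close> and LK = Cons.prems(5) and KL = Cons.prems(6)
  note Mf = ideal_facts[OF M] and Nf = ideal_facts[OF N]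
    and Kf = ideal_facts[OF K] and Lf = ideal_facts[OF L]
  have x: "x \<in> carrier R" using Cons.prems by simp
  then have xp: "x [^] p \<in> carrier R" by simp
  have "z \<in> L" if z: "z \<in> N" "x \<otimes> z \<in> L" for z
  proof -
    have zc: "z \<in> carrier R" using z Nf by auto
    have "x [^] p \<otimes> z [^] p = (x \<otimes> z) [^] p"
      using nat_pow_distrib x zc by simp
    then have "z [^] p \<in> K"
      using Cons.prems(8) NM[OF z(1)] LK[OF z(2)] by simp
    then show ?thesis using KL[of "z [^] p"] split_pow zc by simp
  qed
  moreover have "wreg R N (add_smult R L x N) xs"
  proof (rule Cons.IH)
    show "ideal (add_smult R K (x [^] p) M) R" "ideal (add_smult R L x N) R"
      by (intro ideal_add_smult K L M N x xp)+
    show "add_smult R K (x [^] p) M \<subseteq> M" "add_smult R L x N \<subseteq> N"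
      by (intro add_smult_subset M N x xp Cons.prems)+
    show "set xs \<subseteq> carrier R" "wreg R M (add_smult R K (x [^] p) M) (map (\<lambda>x. x [^] p) xs)"
      using Cons.prems by simp_all
    show "a [^] p \<in> add_smult R K (x [^] p) M" if prem: "a \<in> add_smult R L x N" for a
    proof -
      obtain l z where l: "l \<in> L" "z \<in> N" "a = l \<oplus> x \<otimes> z" using prem unfolding mem_add_smult by blast
      then have "a [^] p = l [^] p \<oplus> x [^] p \<otimes> z [^] p"
        using frob_add[of l "x \<otimes> z"] nat_pow_distrib[of x z] x Lf Nf by simp
      then show ?thesis unfolding mem_add_smult using l LK NM by blast
    qed
    show "\<phi> f \<in> add_smult R L x N" if prem: "f \<in> add_smult R K (x [^] p) M" for f
    proof -
      obtain k z where k: "k \<in> K" "z \<in> M" "f = k \<oplus> x [^] p \<otimes> z"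
        using prem unfolding mem_add_smult by blast
      then have "\<phi> f = \<phi> k \<oplus> x \<otimes> \<phi> z"
        using split_add[of k "x [^] p \<otimes> z"] split_mult[of x z] x Kf Mf by simp
      then show ?thesis unfolding mem_add_smult using k KL MN by blast
    qed
  qed
  ultimately show ?case by simp
qed

text \<open>The elements that \<open>\<phi>\<close> sends into \<open>A N\<close> are in general
  stable only under multiplication by \<open>p\<close>-th powers, so minimality of
  \<open>ideal_mult\<close> does not apply. Explicit sums do pass through, as
  \<open>\<phi>(s\<^sup>p z) = s \<phi>(z)\<close>.\<close>

lemma split_ideal_mult:
  assumes M: "ideal M R" and N: "ideal N R" and MN: "\<And>f. f \<in> M \<Longrightarrow> \<phi> f \<in> N"
    and "finite A" "A \<subseteq> carrier R" "f \<in> ideal_mult R ((\<lambda>s. s [^] p) ` A) (ideal_module R M)"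
  shows "\<phi> f \<in> ideal_mult R A (ideal_module R N)"
  using assms(4-)
proof (induction A arbitrary: f rule: finite_induct)
  case empty
  then show ?case using M N by (simp add: ideal_mult_empty split_zero)
next
  case (insert s A)
  have s: "s \<in> carrier R" and A: "A \<subseteq> carrier R" "(\<lambda>s. s [^] p) ` A \<subseteq> carrier R"
    using insert.prems by auto
  let ?K = "ideal_mult R ((\<lambda>s. s [^] p) ` A) (ideal_module R M)"
  have "f \<in> add_smult R ?K (s [^] p) M"
    using insert.prems(2) ideal_mult_insert[OF M A(2), of "s [^] p"] s by simp
  then obtain k z where k: "k \<in> ?K" "z \<in> M" "f = k \<oplus> s [^] p \<otimes> z"
    unfolding mem_add_smult by blast
  have "k \<in> carrier R"
    using ideal_mult_props(2)[OF M A(2)] k ideal_facts(1)[OF M] by blast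
  then have "\<phi> f = \<phi> k \<oplus> s \<otimes> \<phi> z"
    using k s split_add[of k "s [^] p \<otimes> z"] split_mult[of s z] ideal_facts(1)[OF M] by simp
  moreover have "\<phi> k \<in> ideal_mult R A (ideal_module R N)"
    using insert.IH k A by blast
  ultimately show ?case
    unfolding ideal_mult_insert[OF N A(1) s] mem_add_smult using MN k by blast
qed

text \<open>The convention for infinite depth forces a case distinction. If
  \<open>\<mm> N \<noteq> N\<close>, then also \<open>\<mm> M \<noteq> M\<close>, both depths are
  suprema, and every \<open>M\<close>-regular sequence in \<open>\<mm>\<close> is
  \<open>N\<close>-regular.\<close>

lemma depth_split_le:
  assumes noeth: "noetherian_ring R" and \<mm>: "\<mm> \<subseteq> carrier R" and M: "ideal M R" and N: "ideal N R"
    and NM: "\<And>a. a \<in> N \<Longrightarrow> a [^] p \<in> M" and MN: "\<And>f. f \<in> M \<Longrightarrow> \<phi> f \<in> N"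
  shows "depth R \<mm> (ideal_module R M) \<le> depth R \<mm> (ideal_module R N)"
proof (cases "ideal_mult R \<mm> (ideal_module R N) = N")
  case True
  then show ?thesis by (simp add: depth_def)
next
  case nN: False
  have nM: "ideal_mult R \<mm> (ideal_module R M) \<noteq> M"
  proof
    assume eq: "ideal_mult R \<mm> (ideal_module R M) = M"
    \<comment> \<open>\<open>M = \<mm>M\<close> gives \<open>M = \<mm>\<^sup>[\<^sup>p\<^sup>]M\<close>, since \<open>\<mm>\<close> is finitely generated; now apply \<open>\<phi>\<close>.\<close>
    obtain A where A: "A \<subseteq> carrier R" "finite A" "Idl \<mm> = Idl A"
      using noetherian_ring.finetely_gen[OF noeth genideal_ideal[OF \<mm>]] by blast
    have "ideal_mult R (A \<union> {}) (ideal_module R M) = M"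
      using eq ideal_mult_genideal[OF M \<mm>] ideal_mult_genideal[OF M A(1)] A(3) by simp
    then have full: "ideal_mult R ((\<lambda>s. s [^] p) ` A) (ideal_module R M) = M"
      using ideal_mult_pow_full[OF M A(2,1), of "{}" p] by simp
    have "N \<subseteq> ideal_mult R A (ideal_module R N)"
    proof
      fix a assume a: "a \<in> N"
      then have "\<phi> (a [^] p) \<in> ideal_mult R A (ideal_module R N)"
        using full NM by (intro split_ideal_mult[OF M N MN A(2,1)]) auto
      then show "a \<in> ideal_mult R A (ideal_module R N)"
        using split_pow a ideal_facts(1)[OF N] by simp
    qed
    then have "ideal_mult R \<mm> (ideal_module R N) = N"
      using ideal_mult_genideal[OF N \<mm>] ideal_mult_genideal[OF N A(1)] A(3)
        ideal_mult_props(2)[OF N A(1)] by simp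
    then show False using nN by simp
  qed
  have "regular_seq R (ideal_module R N) xs"
    if xs: "set xs \<subseteq> \<mm>" "regular_seq R (ideal_module R M) xs" for xs
  proof -
    have xc: "set xs \<subseteq> carrier R" using xs \<mm> by auto
    note M0 = ideal_facts(2)[OF M] and N0 = ideal_facts(2)[OF N]
    have "wreg R M {\<zero>} (map (\<lambda>x. x [^] p) xs)"
      using regular_seq_imp_wreg[OF M xs(2)] M M0 xc p_pos
      by (intro wreg_map_pow zeroideal) auto
    then have "wreg R N {\<zero>} xs"
      using M0 N0 xc zero_pow_p split_zero NM MN
      by (intro wreg_split[OF M N NM MN, where K = "{\<zero>}"] zeroideal) auto
    \<comment> \<open>Properness is not inherited from \<open>M\<close> but follows from
      \<open>(xs) N \<subseteq> \<mm> N\<close>, which is a proper part of \<open>N\<close>.\<close>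
    moreover have "ideal_mult R (set xs) (ideal_module R N) \<noteq> N"
      using ideal_mult_mono[OF N xs(1) \<mm>] ideal_mult_props(2)[OF N \<mm>] nN by auto
    ultimately show ?thesis by (intro wreg_imp_regular_seq N xc)
  qed
  then show ?thesis
    unfolding depth_def using nM nN by (auto intro!: Sup_subset_mono)
qed

end

section \<open>Localizations of ideals\<close>

lemma restrict_eq_iff: "restrict f A = restrict g A \<longleftrightarrow> (\<forall>x\<in>A. f x = g x)"
  by (metis restrict_apply' restrict_ext)

text \<open>The operations on fractions are unions over all representatives. Once the result is
  independent of the representative, the union collapses to a single class.\<close>

lemma UN_pair_const:
  assumes "x \<in> A" "\<And>n l. (n, l) \<in> A \<Longrightarrow> F n l = c"
  shows "\<Union>((\<lambda>(n, l). F n l) ` A) = c"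
  using assms by (intro UN_constant_eq) auto

lemma UN_pair_const2:
  assumes "x \<in> A \<times> B" "\<And>n l n' l'. (n, l) \<in> A \<Longrightarrow> (n', l') \<in> B \<Longrightarrow> F n l n' l' = c"
  shows "\<Union>((\<lambda>((n, l), (n', l')). F n l n' l') ` (A \<times> B)) = c"
  using assms by (intro UN_constant_eq) auto

context cring
begin

abbreviation frac :: "'a set \<Rightarrow> 'a \<Rightarrow> 'a \<Rightarrow> nat \<Rightarrow> ('a \<times> nat) set" where
  "frac J \<equiv> loc_frac R (ideal_module R J)"

abbreviation loc :: "'a set \<Rightarrow> 'a \<Rightarrow> ('a, ('a \<times> nat) set) module" where
  "loc J \<equiv> loc_module R (ideal_module R J)"

text \<open>This is \<open>m / f\<^sup>k = m' / f\<^sup>k\<^sup>'\<close>, with the factor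
  \<open>f [^] t\<close> accounting for zero divisors. It does not mention the ideal, so it can
  compare numerators from \<open>M\<close> and from \<open>N\<close> alike.\<close>

definition frac_eq :: "'a \<Rightarrow> 'a \<Rightarrow> nat \<Rightarrow> 'a \<Rightarrow> nat \<Rightarrow> bool" where
  "frac_eq f m k m' k' \<longleftrightarrow> (\<exists>t::nat. f [^] t \<otimes> (f [^] k' \<otimes> m) = f [^] t \<otimes> (f [^] k \<otimes> m'))"

lemma mem_frac: "(m', k') \<in> frac J f m k \<longleftrightarrow> m' \<in> J \<and> frac_eq f m k m' k'"
  by (simp add: loc_frac_def frac_eq_def)

lemma frac_eq_refl: "frac_eq f m k m k"
  by (simp add: frac_eq_def)

lemma frac_eq_sym: "frac_eq f m k m' k' \<Longrightarrow> frac_eq f m' k' m k"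
  unfolding frac_eq_def by metis

lemma frac_eq_trans:
  assumes "frac_eq f m k m' k'" "frac_eq f m' k' m'' k''"
    and c: "f \<in> carrier R" "m \<in> carrier R" "m' \<in> carrier R" "m'' \<in> carrier R"
  shows "frac_eq f m k m'' k''"
proof -
  obtain t :: nat where t: "f [^] t \<otimes> (f [^] k' \<otimes> m) = f [^] t \<otimes> (f [^] k \<otimes> m')"
    using assms by (auto simp: frac_eq_def)
  obtain s :: nat where s: "f [^] s \<otimes> (f [^] k'' \<otimes> m') = f [^] s \<otimes> (f [^] k' \<otimes> m'')"
    using assms by (auto simp: frac_eq_def)
  \<comment> \<open>The exponent combines the multipliers \<open>t\<close> and \<open>s\<close> with
    the denominator \<open>k'\<close> of the middle fraction, through which \<open>m'\<close> is
    eliminated.\<close>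
  have "f [^] (t + s + k') \<otimes> (f [^] k'' \<otimes> m) = f [^] s \<otimes> f [^] k'' \<otimes> (f [^] t \<otimes> (f [^] k' \<otimes> m))"
    using c by (simp add: nat_pow_mult[symmetric] m_ac)
  also have "\<dots> = f [^] t \<otimes> f [^] k \<otimes> (f [^] s \<otimes> (f [^] k'' \<otimes> m'))"
    unfolding t using c by (simp add: m_ac)
  also have "\<dots> = f [^] (t + s + k') \<otimes> (f [^] k \<otimes> m'')"
    unfolding s using c by (simp add: nat_pow_mult[symmetric] m_ac)
  finally show ?thesis
    unfolding frac_eq_def by blast
qed

lemma frac_eq_iff:
  assumes J: "ideal J R" and f: "f \<in> carrier R" and m: "m \<in> J" "m' \<in> J"
  shows "frac J f m k = frac J f m' k' \<longleftrightarrow> frac_eq f m k m' k'"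
proof
  have "(m', k') \<in> frac J f m' k'" using m by (simp add: mem_frac frac_eq_refl)
  then show "frac J f m k = frac J f m' k' \<Longrightarrow> frac_eq f m k m' k'"
    using mem_frac by blast
next
  note Jc = ideal_facts(1)[OF J]
  assume "frac_eq f m k m' k'"
  then have "frac_eq f m k n l \<longleftrightarrow> frac_eq f m' k' n l" if "n \<in> J" for n l
    using frac_eq_trans[OF _ _ f, of m' k' m k n l] frac_eq_trans[OF _ _ f, of m k m' k' n l]
      frac_eq_sym m Jc that by blast
  then have "y \<in> frac J f m k \<longleftrightarrow> y \<in> frac J f m' k'" for y
    by (cases y) (simp only: mem_frac, blast)
  then show "frac J f m k = frac J f m' k'" by blast
qed

lemma frac_eq_scale:
  assumes "f \<in> carrier R" "m \<in> carrier R"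
  shows "frac_eq f m k (f [^] j \<otimes> m) (k + j)"
  using assms by (auto simp: frac_eq_def nat_pow_mult[symmetric] m_assoc)

lemma frac_scale:
  assumes "ideal J R" "f \<in> carrier R" "m \<in> J"
  shows "frac J f (f [^] j \<otimes> m) (k + j) = frac J f m k"
  using frac_eq_scale[of f m k j] assms ideal_facts(1,6)[OF assms(1)]
  by (subst frac_eq_iff) (auto intro: frac_eq_sym)

lemma frac_zero:
  assumes "ideal J R" "f \<in> carrier R"
  shows "frac J f \<zero> k = \<zero>\<^bsub>loc J f\<^esub>"
  using assms ideal_facts(2)[OF assms(1)]
  by (simp add: loc_module_def frac_eq_iff) (simp add: frac_eq_def)

lemma frac_closed: "m \<in> J \<Longrightarrow> frac J f m k \<in> carrier (loc J f)"
  by (auto simp: loc_module_def)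

lemma frac_cases:
  assumes "u \<in> carrier (loc J f)"
  obtains m k where "m \<in> J" "u = frac J f m k"
  using assms by (auto simp: loc_module_def)

lemma frac_add:
  assumes J: "ideal J R" and f: "f \<in> carrier R" and m: "m \<in> J" "m' \<in> J"
  shows "frac J f m k \<oplus>\<^bsub>loc J f\<^esub> frac J f m' k' = frac J f (f [^] k' \<otimes> m \<oplus> f [^] k \<otimes> m') (k + k')"
proof -
  note Jf = ideal_facts[OF J]
  have key: "frac J f (f [^] l' \<otimes> n \<oplus> f [^] l \<otimes> n') (l + l') = frac J f (f [^] k' \<otimes> m \<oplus> f [^] k \<otimes> m') (k + k')"
    if n: "n \<in> J" "n' \<in> J" and e: "frac_eq f m k n l" "frac_eq f m' k' n' l'" for n l n' l'
  proof -
    have c: "m \<in> carrier R" "m' \<in> carrier R" "n \<in> carrier R" "n' \<in> carrier R"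
      using m n Jf by auto
    obtain t :: nat where t: "f [^] t \<otimes> (f [^] l \<otimes> m) = f [^] t \<otimes> (f [^] k \<otimes> n)"
      using e by (auto simp: frac_eq_def)
    obtain s :: nat where s: "f [^] s \<otimes> (f [^] l' \<otimes> m') = f [^] s \<otimes> (f [^] k' \<otimes> n')"
      using e by (auto simp: frac_eq_def)
    have "f [^] (t + s) \<otimes> (f [^] (k + k') \<otimes> (f [^] l' \<otimes> n \<oplus> f [^] l \<otimes> n'))
        = f [^] s \<otimes> f [^] k' \<otimes> f [^] l' \<otimes> (f [^] t \<otimes> (f [^] k \<otimes> n))
          \<oplus> f [^] t \<otimes> f [^] k \<otimes> f [^] l \<otimes> (f [^] s \<otimes> (f [^] k' \<otimes> n'))"
      using f c by (simp add: nat_pow_mult[symmetric] r_distr m_ac)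
    also have "\<dots> = f [^] (t + s) \<otimes> (f [^] (l + l') \<otimes> (f [^] k' \<otimes> m \<oplus> f [^] k \<otimes> m'))"
      unfolding t[symmetric] s[symmetric]
      using f c by (simp add: nat_pow_mult[symmetric] r_distr m_ac)
    finally have "frac_eq f (f [^] l' \<otimes> n \<oplus> f [^] l \<otimes> n') (l + l') (f [^] k' \<otimes> m \<oplus> f [^] k \<otimes> m') (k + k')"
      unfolding frac_eq_def by blast
    then show ?thesis
      using f m n Jf by (subst frac_eq_iff[OF J f]) auto
  qed
  have mem: "((m, k), (m', k')) \<in> frac J f m k \<times> frac J f m' k'"
    using m by (simp add: mem_frac frac_eq_refl)
  show ?thesis
    unfolding loc_module_def ring.simps ideal_module_simps
    by (rule UN_pair_const2[OF mem]) (use key in \<open>unfold mem_frac, blast\<close>)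
qed

lemma frac_add_same:
  assumes J: "ideal J R" and f: "f \<in> carrier R" and m: "m \<in> J" "m' \<in> J"
  shows "frac J f m k \<oplus>\<^bsub>loc J f\<^esub> frac J f m' k = frac J f (m \<oplus> m') k"
proof -
  note Jf = ideal_facts[OF J]
  have "f [^] k \<otimes> m \<oplus> f [^] k \<otimes> m' = f [^] k \<otimes> (m \<oplus> m')"
    using f m Jf by (simp add: r_distr)
  then show ?thesis
    using frac_scale[OF J f, of "m \<oplus> m'" k k] m Jf by (simp add: frac_add[OF J f m])
qed

lemma frac_smult:
  assumes J: "ideal J R" and f: "f \<in> carrier R" and a: "a \<in> carrier R" and m: "m \<in> J"
  shows "a \<odot>\<^bsub>loc J f\<^esub> frac J f m k = frac J f (a \<otimes> m) k"
proof -
  note Jf = ideal_facts[OF J]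
  have key: "frac J f (a \<otimes> n) l = frac J f (a \<otimes> m) k" if n: "n \<in> J" and e: "frac_eq f m k n l" for n l
  proof -
    have c: "m \<in> carrier R" "n \<in> carrier R" using m n Jf by auto
    obtain t :: nat where t: "f [^] t \<otimes> (f [^] l \<otimes> m) = f [^] t \<otimes> (f [^] k \<otimes> n)"
      using e by (auto simp: frac_eq_def)
    have "f [^] t \<otimes> (f [^] l \<otimes> (a \<otimes> m)) = a \<otimes> (f [^] t \<otimes> (f [^] l \<otimes> m))"
      using a c f by (simp add: m_ac)
    also have "\<dots> = f [^] t \<otimes> (f [^] k \<otimes> (a \<otimes> n))"
      unfolding t using a c f by (simp add: m_ac)
    finally have "frac_eq f (a \<otimes> m) k (a \<otimes> n) l"
      unfolding frac_eq_def by blast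
    then show ?thesis
      using f m n a Jf by (subst frac_eq_iff[OF J f]) (auto intro: frac_eq_sym)
  qed
  have mem: "(m, k) \<in> frac J f m k"
    using m by (simp add: mem_frac frac_eq_refl)
  show ?thesis
    unfolding loc_module_def module.simps ideal_module_simps
    by (rule UN_pair_const[OF mem]) (use key in \<open>unfold mem_frac, blast\<close>)
qed

lemma loc_map_frac:
  assumes J: "ideal J R" and f: "f \<in> carrier R" and g: "g \<in> carrier R" and m: "m \<in> J"
  shows "loc_map R (ideal_module R J) g (f \<otimes> g) (frac J f m k) = frac J (f \<otimes> g) (g [^] k \<otimes> m) k"
proof -
  note Jf = ideal_facts[OF J]
  have key: "frac J (f \<otimes> g) (g [^] l \<otimes> n) l = frac J (f \<otimes> g) (g [^] k \<otimes> m) k"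
    if n: "n \<in> J" and e: "frac_eq f m k n l" for n l
  proof -
    have c: "m \<in> carrier R" "n \<in> carrier R" using m n Jf by auto
    obtain t :: nat where t: "f [^] t \<otimes> (f [^] l \<otimes> m) = f [^] t \<otimes> (f [^] k \<otimes> n)"
      using e by (auto simp: frac_eq_def)
    have "(f \<otimes> g) [^] t \<otimes> ((f \<otimes> g) [^] l \<otimes> (g [^] k \<otimes> m))
        = g [^] t \<otimes> g [^] l \<otimes> g [^] k \<otimes> (f [^] t \<otimes> (f [^] l \<otimes> m))"
      using f g c by (simp add: nat_pow_distrib m_ac)
    also have "\<dots> = (f \<otimes> g) [^] t \<otimes> ((f \<otimes> g) [^] k \<otimes> (g [^] l \<otimes> n))"
      unfolding t using f g c by (simp add: nat_pow_distrib m_ac)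
    finally have "frac_eq (f \<otimes> g) (g [^] k \<otimes> m) k (g [^] l \<otimes> n) l"
      unfolding frac_eq_def by blast
    then show ?thesis
      using f m n g Jf by (subst frac_eq_iff[OF J]) (auto intro: frac_eq_sym)
  qed
  have mem: "(m, k) \<in> frac J f m k"
    using m by (simp add: mem_frac frac_eq_refl)
  show ?thesis
    unfolding loc_map_def ideal_module_simps
    by (rule UN_pair_const[OF mem]) (use key in \<open>unfold mem_frac, blast\<close>)
qed

lemma frac_common3:
  assumes J: "ideal J R" and f: "f \<in> carrier R"
    and "u \<in> carrier (loc J f)" "v \<in> carrier (loc J f)" "w \<in> carrier (loc J f)"
  obtains a b c k where "a \<in> J" "b \<in> J" "c \<in> J" "u = frac J f a k" "v = frac J f b k" "w = frac J f c k"
proof -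
  note Jf = ideal_facts[OF J]
  obtain a k where a: "a \<in> J" "u = frac J f a k" using frac_cases assms by blast
  obtain b l where b: "b \<in> J" "v = frac J f b l" using frac_cases assms by blast
  obtain c j where c: "c \<in> J" "w = frac J f c j" using frac_cases assms by blast
  have "u = frac J f (f [^] (l + j) \<otimes> a) (k + l + j)"
    using frac_scale[OF J f a(1), of "l + j" k] a(2) by (simp add: add.assoc)
  moreover have "v = frac J f (f [^] (k + j) \<otimes> b) (k + l + j)"
    using frac_scale[OF J f b(1), of "k + j" l] b(2) by (simp add: ac_simps)
  moreover have "w = frac J f (f [^] (k + l) \<otimes> c) (k + l + j)"
    using frac_scale[OF J f c(1), of "k + l" j] c(2) by (simp add: ac_simps)
  moreover have "f [^] (l + j) \<otimes> a \<in> J" "f [^] (k + j) \<otimes> b \<in> J" "f [^] (k + l) \<otimes> c \<in> J"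
    using a b c f Jf by auto
  ultimately show ?thesis using that by blast
qed

text \<open>The Cech differential is a \<open>finsum\<close> in the localization, and the rules for
  \<open>finsum\<close> rest on this structure.\<close>

lemma abelian_monoid_loc:
  assumes J: "ideal J R" and f: "f \<in> carrier R"
  shows "abelian_monoid (loc J f)"
proof (rule abelian_monoidI)
  note Jf = ideal_facts[OF J] and add = frac_add_same[OF J f]
  show "\<zero>\<^bsub>loc J f\<^esub> \<in> carrier (loc J f)"
    using frac_closed[OF Jf(2)] frac_zero[OF J f, of 0] by metis
  fix u v assume u: "u \<in> carrier (loc J f)" and v: "v \<in> carrier (loc J f)"
  obtain a b c k where uv: "a \<in> J" "b \<in> J" "u = frac J f a k" "v = frac J f b k"
    by (rule frac_common3[OF J f u v v])
  show "u \<oplus>\<^bsub>loc J f\<^esub> v \<in> carrier (loc J f)"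
    using uv Jf by (auto simp: add intro: frac_closed)
  show "u \<oplus>\<^bsub>loc J f\<^esub> v = v \<oplus>\<^bsub>loc J f\<^esub> u"
    using uv Jf by (simp add: add a_comm)
  show "\<zero>\<^bsub>loc J f\<^esub> \<oplus>\<^bsub>loc J f\<^esub> u = u"
    using uv Jf unfolding frac_zero[OF J f, of k, symmetric] by (simp add: add)
  fix w assume w: "w \<in> carrier (loc J f)"
  obtain a b c k where uvw: "a \<in> J" "b \<in> J" "c \<in> J" "u = frac J f a k" "v = frac J f b k" "w = frac J f c k"
    by (rule frac_common3[OF J f u v w])
  show "u \<oplus>\<^bsub>loc J f\<^esub> v \<oplus>\<^bsub>loc J f\<^esub> w = u \<oplus>\<^bsub>loc J f\<^esub> (v \<oplus>\<^bsub>loc J f\<^esub> w)"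
    using uvw Jf by (simp add: add a_assoc)
qed

lemma finsum_mem_ideal:
  assumes J: "ideal J R" and "finite A" "\<And>i. i \<in> A \<Longrightarrow> m i \<in> J"
  shows "finsum R m A \<in> J"
  using assms(2,3)
proof (induction A rule: finite_induct)
  case empty
  then show ?case using ideal_facts(2)[OF J] by simp
next
  case (insert i A)
  then show ?case
    using ideal_facts(1,3)[OF J] by (subst finsum_insert) auto
qed

lemma finsum_frac:
  assumes J: "ideal J R" and f: "f \<in> carrier R" and "finite A" "\<And>i. i \<in> A \<Longrightarrow> m i \<in> J"
  shows "finsum (loc J f) (\<lambda>i. frac J f (m i) k) A = frac J f (finsum R m A) k"
proof -
  interpret L: abelian_monoid "loc J f" by (rule abelian_monoid_loc[OF J f])
  show ?thesis
    using assms(3,4)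
  proof (induction A rule: finite_induct)
    case empty
    then show ?case by (simp add: frac_zero[OF J f])
  next
    case (insert i A)
    have "finsum (loc J f) (\<lambda>i. frac J f (m i) k) (insert i A)
        = frac J f (m i) k \<oplus>\<^bsub>loc J f\<^esub> finsum (loc J f) (\<lambda>i. frac J f (m i) k) A"
      using insert by (intro L.finsum_insert) (auto intro: frac_closed)
    also have "\<dots> = frac J f (m i \<oplus> finsum R m A) k"
      using insert finsum_mem_ideal[OF J, of A m] by (simp add: frac_add_same[OF J f])
    also have "m i \<oplus> finsum R m A = finsum R m (insert i A)"
      using insert ideal_facts(1)[OF J] by (intro finsum_insert[symmetric]) auto
    finally show ?case .
  qed
qed

end

section \<open>Cech cochains\<close>

context cring
begin

text \<open>Giving all components of a cochain the same denominator exponent \<open>k\<close> turns the Cech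
  differential into the formula \<open>cech_num\<close> for numerators, with denominator exponent \<open>k\<close> again.\<close>

definition cech_chain :: "'a set \<Rightarrow> 'a list \<Rightarrow> nat \<Rightarrow> (nat set \<Rightarrow> 'a) \<Rightarrow> nat \<Rightarrow> nat set \<Rightarrow> ('a \<times> nat) set" where
  "cech_chain J ys i m k = (\<lambda>I\<in>cech_index ys i. frac J (cech_elem R ys I) (m I) k)"

definition cech_num :: "'a list \<Rightarrow> (nat set \<Rightarrow> 'a) \<Rightarrow> nat \<Rightarrow> nat set \<Rightarrow> 'a" where
  "cech_num ys m k I = (\<Oplus>j\<in>I. (\<ominus> \<one>) [^] card {l \<in> I. l < j} \<otimes> ((ys ! j) [^] k \<otimes> m (I - {j})))"

lemma cech_indexD:
  assumes "I \<in> cech_index ys i"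
  shows "finite I" "I \<subseteq> {..<length ys}" "card I = i"
  using assms finite_subset by (auto simp: cech_index_def)

lemma finite_cech_index: "finite (cech_index ys i)"
  by (rule finite_subset[of _ "Pow {..<length ys}"]) (auto simp: cech_index_def)

lemma nth_cech:
  assumes "set ys \<subseteq> carrier R" "I \<in> cech_index ys i" "j \<in> I"
  shows "ys ! j \<in> carrier R"
  using assms cech_indexD(2)[OF assms(2)] by (meson lessThan_iff nth_mem subsetD)

lemma cech_elem_closed:
  assumes "set ys \<subseteq> carrier R" "I \<in> cech_index ys i"
  shows "cech_elem R ys I \<in> carrier R"
  unfolding cech_elem_def using nth_cech[OF assms] by (intro finprod_closed) auto

lemma cech_index_remove:
  assumes "I \<in> cech_index ys (Suc i)" "j \<in> I"
  shows "I - {j} \<in> cech_index ys i"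
  using assms by (auto simp: cech_index_def)

lemma cech_elem_remove:
  assumes ys: "set ys \<subseteq> carrier R" and I: "I \<in> cech_index ys i" and j: "j \<in> I"
  shows "cech_elem R ys I = cech_elem R ys (I - {j}) \<otimes> ys ! j"
proof -
  have "cech_elem R ys I = cech_elem R ys (insert j (I - {j}))"
    using j by (simp add: insert_absorb)
  also have "\<dots> = ys ! j \<otimes> cech_elem R ys (I - {j})"
    unfolding cech_elem_def using nth_cech[OF ys I] cech_indexD(1)[OF I] j
    by (intro finprod_insert) auto
  also have "\<dots> = cech_elem R ys (I - {j}) \<otimes> ys ! j"
    unfolding cech_elem_def using nth_cech[OF ys I] j
    by (intro m_comm finprod_closed) auto
  finally show ?thesis .
qed

lemma cech_num_closed:
  assumes J: "ideal J R" and ys: "set ys \<subseteq> carrier R" and m: "m \<in> cech_index ys i \<rightarrow> J"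
    and I: "I \<in> cech_index ys (Suc i)"
  shows "cech_num ys m k I \<in> J"
  unfolding cech_num_def
  using nth_cech[OF ys I] cech_indexD(1)[OF I] funcset_mem[OF m] cech_index_remove[OF I]
  by (intro finsum_mem_ideal[OF J] ideal_facts(6)[OF J]) auto

text \<open>Inverting one more element \<open>y\<close> turns \<open>m / f\<^sup>k\<close> into
  \<open>y\<^sup>k m / (f y)\<^sup>k\<close>. The exponent stays the same in every summand, so the
  summands add on numerators.\<close>

lemma cech_diff_chain:
  assumes J: "ideal J R" and ys: "set ys \<subseteq> carrier R" and m: "m \<in> cech_index ys i \<rightarrow> J"
  shows "cech_diff R (ideal_module R J) ys i (cech_chain J ys i m k)
    = cech_chain J ys (Suc i) (cech_num ys m k) k"
  unfolding cech_diff_def cech_chain_def[of _ _ "Suc i"]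
proof (rule restrict_ext)
  fix I assume I: "I \<in> cech_index ys (Suc i)"
  let ?f = "cech_elem R ys I"
  note Jf = ideal_facts[OF J]
  have f: "?f \<in> carrier R" by (rule cech_elem_closed[OF ys I])
  interpret L: abelian_monoid "loc J ?f" by (rule abelian_monoid_loc[OF J f])
  let ?s = "\<lambda>j. (\<ominus> \<one>) [^] card {l \<in> I. l < j}"
  have mem: "?s j \<otimes> ((ys ! j) [^] k \<otimes> m (I - {j})) \<in> J" if "j \<in> I" for j
    using funcset_mem[OF m] nth_cech[OF ys I] cech_index_remove[OF I] that Jf by auto
  have "?s j \<odot>\<^bsub>loc J ?f\<^esub> loc_map R (ideal_module R J) (ys ! j) ?f (cech_chain J ys i m k (I - {j}))
      = frac J ?f (?s j \<otimes> ((ys ! j) [^] k \<otimes> m (I - {j}))) k" if j: "j \<in> I" for j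
  proof -
    have I': "I - {j} \<in> cech_index ys i" by (rule cech_index_remove[OF I j])
    have "loc_map R (ideal_module R J) (ys ! j) ?f (cech_chain J ys i m k (I - {j}))
        = frac J ?f ((ys ! j) [^] k \<otimes> m (I - {j})) k"
      using I' loc_map_frac[OF J cech_elem_closed[OF ys I'] nth_cech[OF ys I j] funcset_mem[OF m I'], of k]
      by (simp add: cech_chain_def cech_elem_remove[OF ys I j])
    then show ?thesis
      using nth_cech[OF ys I j] funcset_mem[OF m I'] Jf by (simp add: frac_smult[OF J f])
  qed
  then have "finsum (loc J ?f) (\<lambda>j. ?s j \<odot>\<^bsub>loc J ?f\<^esub>
        loc_map R (ideal_module R J) (ys ! j) ?f (cech_chain J ys i m k (I - {j}))) I
      = finsum (loc J ?f) (\<lambda>j. frac J ?f (?s j \<otimes> ((ys ! j) [^] k \<otimes> m (I - {j}))) k) I"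
    using mem by (intro L.finsum_cong') (auto intro: frac_closed)
  also have "\<dots> = frac J ?f (cech_num ys m k I) k"
    unfolding cech_num_def by (rule finsum_frac[OF J f cech_indexD(1)[OF I] mem])
  finally show "finsum (loc J ?f) (\<lambda>j. ?s j \<odot>\<^bsub>loc J ?f\<^esub>
      loc_map R (ideal_module R J) (ys ! j) ?f (cech_chain J ys i m k (I - {j}))) I
      = frac J ?f (cech_num ys m k I) k" .
qed

lemma cech_chain_closed:
  assumes "m \<in> cech_index ys i \<rightarrow> J"
  shows "cech_chain J ys i m k \<in> carrier (cech_module R (ideal_module R J) ys i)"
  using assms by (auto simp: cech_chain_def cech_module_def intro: frac_closed)

lemma cech_chain_zero:
  assumes "ideal J R" "set ys \<subseteq> carrier R"
  shows "cech_chain J ys i (\<lambda>_. \<zero>) k = \<zero>\<^bsub>cech_module R (ideal_module R J) ys i\<^esub>"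
  using assms cech_elem_closed[OF assms(2)]
  by (auto simp: cech_chain_def cech_module_def frac_zero intro!: restrict_ext)

lemma cech_chain_add:
  assumes "ideal J R" "set ys \<subseteq> carrier R"
    "m \<in> cech_index ys i \<rightarrow> J" "n \<in> cech_index ys i \<rightarrow> J"
  shows "cech_chain J ys i m k \<oplus>\<^bsub>cech_module R (ideal_module R J) ys i\<^esub> cech_chain J ys i n k
    = cech_chain J ys i (\<lambda>I. m I \<oplus> n I) k"
  using assms cech_elem_closed[OF assms(2)]
  by (auto simp: cech_chain_def cech_module_def frac_add_same Pi_iff intro!: restrict_ext)

lemma cech_chain_eq_iff:
  assumes "ideal J R" "set ys \<subseteq> carrier R"
    "m \<in> cech_index ys i \<rightarrow> J" "n \<in> cech_index ys i \<rightarrow> J"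
  shows "cech_chain J ys i m k = cech_chain J ys i n l \<longleftrightarrow>
    (\<forall>I\<in>cech_index ys i. frac_eq (cech_elem R ys I) (m I) k (n I) l)"
proof -
  have "cech_chain J ys i m k = cech_chain J ys i n l \<longleftrightarrow>
      (\<forall>I\<in>cech_index ys i. frac J (cech_elem R ys I) (m I) k = frac J (cech_elem R ys I) (n I) l)"
    unfolding cech_chain_def by (rule restrict_eq_iff)
  then show ?thesis
    using assms cech_elem_closed[OF assms(2)] by (simp add: frac_eq_iff Pi_iff)
qed

lemma cech_chain_cong:
  "(\<And>I. I \<in> cech_index ys i \<Longrightarrow> m I = n I) \<Longrightarrow> cech_chain J ys i m k = cech_chain J ys i n k"
  by (auto simp: cech_chain_def intro!: restrict_ext)

section \<open>Common denominators\<close>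

lemma cech_common_denominator:
  assumes J: "ideal J R" and ys: "set ys \<subseteq> carrier R"
    and c: "c \<in> carrier (cech_module R (ideal_module R J) ys i)"
    and ck: "\<And>I. I \<in> cech_index ys i \<Longrightarrow> c I = frac J (cech_elem R ys I) (m I) (k I)"
    and m: "m \<in> cech_index ys i \<rightarrow> J"
    and K: "\<And>I. I \<in> cech_index ys i \<Longrightarrow> k I \<le> K"
  shows "c = cech_chain J ys i (\<lambda>I. cech_elem R ys I [^] (K - k I) \<otimes> m I) K"
proof -
  have "c = (\<lambda>I\<in>cech_index ys i. c I)"
    using c by (simp add: cech_module_def PiE_restrict)
  also have "\<dots> = cech_chain J ys i (\<lambda>I. cech_elem R ys I [^] (K - k I) \<otimes> m I) K"
    unfolding cech_chain_def
  proof (rule restrict_ext)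
    fix I assume I: "I \<in> cech_index ys i"
    then show "c I = frac J (cech_elem R ys I) (cech_elem R ys I [^] (K - k I) \<otimes> m I) K"
      using frac_scale[OF J cech_elem_closed[OF ys I] funcset_mem[OF m I], of "K - k I" "k I"] ck[OF I] K[OF I]
      by simp
  qed
  finally show ?thesis .
qed

lemma cech_index_bound:
  fixes k :: "nat set \<Rightarrow> nat"
  assumes "I \<in> cech_index ys i"
  shows "k I \<le> sum k (cech_index ys i)"
  using assms finite_cech_index by (intro member_le_sum) auto

text \<open>An exponent divisible by \<open>p\<close> lets powers of the denominator be pulled out
  of \<open>\<phi>\<close>. The lower bound \<open>k0\<close>, used with \<open>p = 1\<close>,
  serves to bring two cochains to the same exponent.\<close>

lemma cech_chain_exists:
  assumes J: "ideal J R" and ys: "set ys \<subseteq> carrier R"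
    and c: "c \<in> carrier (cech_module R (ideal_module R J) ys i)" and p: "0 < p"
  obtains m k where "m \<in> cech_index ys i \<rightarrow> J" "k0 \<le> k" "c = cech_chain J ys i m (k * p)"
proof -
  have "\<exists>m k. m \<in> J \<and> c I = frac J (cech_elem R ys I) m k" if "I \<in> cech_index ys i" for I
  proof -
    have "c I \<in> carrier (loc J (cech_elem R ys I))"
      using c that by (auto simp: cech_module_def)
    then show ?thesis by (rule frac_cases) blast
  qed
  then obtain m k where mk: "\<forall>I\<in>cech_index ys i. m I \<in> J \<and> c I = frac J (cech_elem R ys I) (m I) (k I)"
    by metis
  then have mJ: "m \<in> cech_index ys i \<rightarrow> J" by blast
  \<comment> \<open>The sum bounds each of the finitely many exponents \<open>k I\<close>, and
    multiplying it by \<open>p\<close> only enlarges it.\<close>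
  let ?K = "k0 + sum k (cech_index ys i)"
  have "k I \<le> ?K * p" if "I \<in> cech_index ys i" for I
  proof -
    have "k I \<le> ?K" using cech_index_bound[OF that, of k] by simp
    also have "?K \<le> ?K * p" using p by simp
    finally show ?thesis .
  qed
  then have "c = cech_chain J ys i (\<lambda>I. cech_elem R ys I [^] (?K * p - k I) \<otimes> m I) (?K * p)"
    using mk by (intro cech_common_denominator[OF J ys c _ mJ]) auto
  moreover have "(\<lambda>I. cech_elem R ys I [^] (?K * p - k I) \<otimes> m I) \<in> cech_index ys i \<rightarrow> J"
    using mJ cech_elem_closed[OF ys] ideal_facts(6)[OF J] by (auto simp: Pi_iff)
  ultimately show ?thesis
    using that[of "\<lambda>I. cech_elem R ys I [^] (?K * p - k I) \<otimes> m I" ?K] by simp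
qed

lemma cech_chain_rescale:
  assumes J: "ideal J R" and ys: "set ys \<subseteq> carrier R" and m: "m \<in> cech_index ys i \<rightarrow> J"
    and "k \<le> K"
  shows "cech_chain J ys i m k = cech_chain J ys i (\<lambda>I. cech_elem R ys I [^] (K - k) \<otimes> m I) K"
  using assms
  by (intro cech_common_denominator[OF J ys cech_chain_closed[OF m]]) (auto simp: cech_chain_def)

lemma cech_num_zero:
  assumes "set ys \<subseteq> carrier R" "I \<in> cech_index ys i"
  shows "cech_num ys (\<lambda>_. \<zero>) k I = \<zero>"
proof -
  have "cech_num ys (\<lambda>_. \<zero>) k I = (\<Oplus>j\<in>I. \<zero>)"
    unfolding cech_num_def using nth_cech[OF assms] by (intro finsum_cong') auto
  then show ?thesis by simp
qed

lemma cech_num_add: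
  assumes ys: "set ys \<subseteq> carrier R" and I: "I \<in> cech_index ys (Suc i)"
    and m: "m \<in> cech_index ys i \<rightarrow> carrier R"
    and n: "n \<in> cech_index ys i \<rightarrow> carrier R"
  shows "cech_num ys (\<lambda>I. m I \<oplus> n I) k I = cech_num ys m k I \<oplus> cech_num ys n k I"
proof -
  let ?s = "\<lambda>j. (\<ominus> \<one>) [^] card {l \<in> I. l < j}"
  have "cech_num ys (\<lambda>I. m I \<oplus> n I) k I
      = (\<Oplus>j\<in>I. ?s j \<otimes> ((ys ! j) [^] k \<otimes> m (I - {j})) \<oplus> ?s j \<otimes> ((ys ! j) [^] k \<otimes> n (I - {j})))"
    unfolding cech_num_def
    using nth_cech[OF ys I] cech_index_remove[OF I] funcset_mem[OF m] funcset_mem[OF n]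
    by (intro finsum_cong') (auto simp: r_distr)
  then show ?thesis
    unfolding cech_num_def
    using nth_cech[OF ys I] cech_index_remove[OF I] funcset_mem[OF m] funcset_mem[OF n]
    by (subst (asm) finsum_addf) auto
qed

section \<open>Coboundaries and cocycles in terms of numerators\<close>

lemma cech_coboundaries_zero:
  assumes J: "ideal J R" and ys: "set ys \<subseteq> carrier R"
  shows "\<zero>\<^bsub>cech_module R (ideal_module R J) ys i\<^esub> \<in> cech_coboundaries R (ideal_module R J) ys i"
proof (cases i)
  case 0
  then show ?thesis by (simp add: cech_coboundaries_def)
next
  case (Suc j)
  have z: "(\<lambda>_. \<zero>) \<in> A \<rightarrow> J" for A :: "nat set set" using ideal_facts(2)[OF J] by simp
  have "cech_diff R (ideal_module R J) ys j (cech_chain J ys j (\<lambda>_. \<zero>) 0)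
      = cech_chain J ys (Suc j) (cech_num ys (\<lambda>_. \<zero>) 0) 0"
    using z by (intro cech_diff_chain[OF J ys])
  also have "\<dots> = cech_chain J ys (Suc j) (\<lambda>_. \<zero>) 0"
    using cech_num_zero[OF ys] by (intro cech_chain_cong)
  also have "\<dots> = \<zero>\<^bsub>cech_module R (ideal_module R J) ys i\<^esub>"
    using cech_chain_zero[OF J ys] Suc by simp
  finally have "\<zero>\<^bsub>cech_module R (ideal_module R J) ys i\<^esub>
      = cech_diff R (ideal_module R J) ys j (cech_chain J ys j (\<lambda>_. \<zero>) 0)" by simp
  moreover have "cech_chain J ys j (\<lambda>_. \<zero>) 0 \<in> carrier (cech_module R (ideal_module R J) ys j)"
    using z by (intro cech_chain_closed)
  ultimately show ?thesis
    unfolding cech_coboundaries_def Suc by (simp del: cech_module_def)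
qed

lemma cech_boundary_chain:
  assumes J: "ideal J R" and ys: "set ys \<subseteq> carrier R"
    and b: "b \<in> cech_coboundaries R (ideal_module R J) ys (Suc j)" and p: "0 < p"
  obtains n l where "n \<in> cech_index ys j \<rightarrow> J" "k0 \<le> l"
    "b = cech_chain J ys (Suc j) (cech_num ys n (l * p)) (l * p)"
proof -
  obtain a where a: "a \<in> carrier (cech_module R (ideal_module R J) ys j)"
    "b = cech_diff R (ideal_module R J) ys j a"
    using b by (auto simp: cech_coboundaries_def)
  obtain n l where n: "n \<in> cech_index ys j \<rightarrow> J" "k0 \<le> l" "a = cech_chain J ys j n (l * p)"
    using cech_chain_exists[OF J ys a(1) p, of k0] by metis
  then show ?thesis
    using that[of n l] a(2) cech_diff_chain[OF J ys n(1)] by simp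
qed

lemma cech_boundary_chain_mem:
  assumes J: "ideal J R" and ys: "set ys \<subseteq> carrier R" and n: "n \<in> cech_index ys j \<rightarrow> J"
  shows "cech_chain J ys (Suc j) (cech_num ys n l) l \<in> cech_coboundaries R (ideal_module R J) ys (Suc j)"
  unfolding cech_coboundaries_def
  using cech_diff_chain[OF J ys n, of l, symmetric] cech_chain_closed[OF n]
  by simp

text \<open>It is the primitive \<open>m\<close> that is rescaled, not the boundary, so that the
  result is again given by \<open>cech_num\<close>.\<close>

lemma cech_boundary_common:
  assumes J: "ideal J R" and ys: "set ys \<subseteq> carrier R"
    and b: "b \<in> cech_coboundaries R (ideal_module R J) ys (Suc j)"
    and c: "c \<in> cech_coboundaries R (ideal_module R J) ys (Suc j)"
  obtains m n l where "m \<in> cech_index ys j \<rightarrow> J" "n \<in> cech_index ys j \<rightarrow> J"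
    "b = cech_chain J ys (Suc j) (cech_num ys m l) l" "c = cech_chain J ys (Suc j) (cech_num ys n l) l"
proof -
  obtain m k where m: "m \<in> cech_index ys j \<rightarrow> J"
    "b = cech_chain J ys (Suc j) (cech_num ys m k) k"
    using cech_boundary_chain[OF J ys b, of 1] by (metis less_numeral_extra(1) mult_1_right)
  obtain n l where n: "n \<in> cech_index ys j \<rightarrow> J" "k \<le> l"
    "c = cech_chain J ys (Suc j) (cech_num ys n l) l"
    using cech_boundary_chain[OF J ys c, of 1 k] by (metis less_numeral_extra(1) mult_1_right)
  let ?m = "\<lambda>I. cech_elem R ys I [^] (l - k) \<otimes> m I"
  have m': "?m \<in> cech_index ys j \<rightarrow> J"
    using m(1) cech_elem_closed[OF ys] ideal_facts(6)[OF J] by (auto simp: Pi_iff)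
  have "b = cech_chain J ys (Suc j) (cech_num ys ?m l) l"
    using m(2) cech_diff_chain[OF J ys m(1), of k] cech_diff_chain[OF J ys m', of l]
      cech_chain_rescale[OF J ys m(1) n(2)] by simp
  then show ?thesis using that m' n by blast
qed

text \<open>Two properties of the coboundaries suffice: they contain zero, and they are stable under
  adding or subtracting one of them. The second is checked on numerators of primitives over a common
  exponent.\<close>

lemma cech_coset_eq_iff:
  assumes J: "ideal J R" and ys: "set ys \<subseteq> carrier R"
    and c: "c \<in> carrier (cech_module R (ideal_module R J) ys i)"
  shows "cech_coboundaries R (ideal_module R J) ys i +>\<^bsub>cech_module R (ideal_module R J) ys i\<^esub> c
      = cech_coboundaries R (ideal_module R J) ys i
    \<longleftrightarrow> c \<in> cech_coboundaries R (ideal_module R J) ys i"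
proof -
  let ?C = "cech_module R (ideal_module R J) ys i"
  let ?B = "cech_coboundaries R (ideal_module R J) ys i"
  note Jf = ideal_facts[OF J]
  have coset: "?B +>\<^bsub>?C\<^esub> c = {b \<oplus>\<^bsub>?C\<^esub> c |b. b \<in> ?B}"
    by (auto simp: a_r_coset_def r_coset_def)
  have zero_add: "\<zero>\<^bsub>?C\<^esub> \<oplus>\<^bsub>?C\<^esub> c = c"
  proof -
    obtain m k where m: "m \<in> cech_index ys i \<rightarrow> J" "c = cech_chain J ys i m k"
      using cech_chain_exists[OF J ys c, of 1] by (metis less_numeral_extra(1) mult_1_right)
    have "\<zero>\<^bsub>?C\<^esub> \<oplus>\<^bsub>?C\<^esub> c = cech_chain J ys i (\<lambda>I. \<zero> \<oplus> m I) k"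
      unfolding cech_chain_zero[OF J ys, of i k, symmetric] m(2)
      using Jf(2) by (intro cech_chain_add[OF J ys _ m(1)]) auto
    also have "\<dots> = c" unfolding m(2) using m(1) Jf(1) by (intro cech_chain_cong) (auto simp: Pi_iff)
    finally show ?thesis .
  qed
  show ?thesis
  proof
    assume "?B +>\<^bsub>?C\<^esub> c = ?B"
    moreover have "\<zero>\<^bsub>?C\<^esub> \<oplus>\<^bsub>?C\<^esub> c \<in> ?B +>\<^bsub>?C\<^esub> c"
      unfolding coset using cech_coboundaries_zero[OF J ys, of i] by blast
    ultimately show "c \<in> ?B" using zero_add by simp
  next
    assume cB: "c \<in> ?B"
    show "?B +>\<^bsub>?C\<^esub> c = ?B"
    proof (cases i)
      case 0
      then have B: "?B = {\<zero>\<^bsub>?C\<^esub>}" by (simp add: cech_coboundaries_def)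
      then have "c = \<zero>\<^bsub>?C\<^esub>" using cB by simp
      then show ?thesis unfolding coset using B zero_add by auto
    next
      case (Suc j)
      have key: "b \<oplus>\<^bsub>?C\<^esub> c \<in> ?B \<and> (\<exists>b'\<in>?B. b = b' \<oplus>\<^bsub>?C\<^esub> c)" if bB: "b \<in> ?B" for b
      proof -
        obtain m n l where m: "m \<in> cech_index ys j \<rightarrow> J"
            "b = cech_chain J ys i (cech_num ys m l) l"
          and n: "n \<in> cech_index ys j \<rightarrow> J" "c = cech_chain J ys i (cech_num ys n l) l"
          using cech_boundary_common[OF J ys] bB cB unfolding Suc by metis
        have closed: "cech_num ys q l \<in> cech_index ys i \<rightarrow> J"
          if "q \<in> cech_index ys j \<rightarrow> J" for q
          using cech_num_closed[OF J ys that] Suc by blast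
        have add: "cech_chain J ys i (cech_num ys q l) l \<oplus>\<^bsub>?C\<^esub> cech_chain J ys i (cech_num ys r l) l
            = cech_chain J ys i (cech_num ys (\<lambda>I. q I \<oplus> r I) l) l"
          if q: "q \<in> cech_index ys j \<rightarrow> J" and r: "r \<in> cech_index ys j \<rightarrow> J" for q r
        proof -
          have "cech_chain J ys i (cech_num ys q l) l \<oplus>\<^bsub>?C\<^esub> cech_chain J ys i (cech_num ys r l) l
            = cech_chain J ys i (\<lambda>I. cech_num ys q l I \<oplus> cech_num ys r l I) l"
            by (intro cech_chain_add[OF J ys] closed q r)
          also have "\<dots> = cech_chain J ys i (cech_num ys (\<lambda>I. q I \<oplus> r I) l) l"
            using cech_num_add[OF ys, of _ j q r] q r Jf(1) Suc
            by (intro cech_chain_cong) (auto simp: Pi_iff)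
          finally show ?thesis .
        qed
        have bc: "b \<oplus>\<^bsub>?C\<^esub> c \<in> ?B"
          unfolding m(2) n(2) add[OF m(1) n(1)] unfolding Suc
          using m(1) n(1) Jf(3) by (intro cech_boundary_chain_mem[OF J ys]) auto
        \<comment> \<open>The difference of the primitives is a primitive of \<open>b - c\<close>,
          which exhibits \<open>b\<close> as an element of the coset of \<open>c\<close>.\<close>
        let ?d = "\<lambda>I. m I \<ominus> n I"
        have d: "?d \<in> cech_index ys j \<rightarrow> J"
          using m(1) n(1) Jf(5) by auto
        have "cech_chain J ys i (cech_num ys ?d l) l \<oplus>\<^bsub>?C\<^esub> c
            = cech_chain J ys i (cech_num ys (\<lambda>I. ?d I \<oplus> n I) l) l"
          unfolding n(2) by (rule add[OF d n(1)])
        also have "\<dots> = b"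
          unfolding m(2)
        proof (rule cech_chain_cong)
          fix I assume I: "I \<in> cech_index ys i"
          have "?d (I - {x}) \<oplus> n (I - {x}) = m (I - {x})" if "x \<in> I" for x
          proof -
            have "I - {x} \<in> cech_index ys j"
              using cech_index_remove[of I ys j x] I that Suc by simp
            then have "m (I - {x}) \<in> carrier R" "n (I - {x}) \<in> carrier R"
              using m(1) n(1) Jf(1) by blast+
            then show ?thesis by algebra
          qed
          moreover have "m (I - {x}) \<in> carrier R" if "x \<in> I" for x
            using m(1) Jf(1) cech_index_remove[of I ys j x] I that Suc by blast
          ultimately show "cech_num ys (\<lambda>I. ?d I \<oplus> n I) l I = cech_num ys m l I"
            unfolding cech_num_def using nth_cech[OF ys I] by (intro finsum_cong') auto
        qed
        finally have "b = cech_chain J ys i (cech_num ys ?d l) l \<oplus>\<^bsub>?C\<^esub> c" by simp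
        moreover have "cech_chain J ys i (cech_num ys ?d l) l \<in> ?B"
          unfolding Suc by (rule cech_boundary_chain_mem[OF J ys d])
        ultimately show ?thesis using bc by blast
      qed
      show ?thesis
        unfolding coset using key by blast
    qed
  qed
qed

text \<open>A fraction is zero when some power of its denominator kills the numerator. For a cocycle
  \<open>cech_num\<close> itself may therefore be nonzero, and the exponent \<open>t\<close> depends
  on \<open>I\<close>.\<close>

lemma cech_chain_cocycle_iff:
  assumes J: "ideal J R" and ys: "set ys \<subseteq> carrier R" and m: "m \<in> cech_index ys i \<rightarrow> J"
  shows "cech_chain J ys i m k \<in> cech_cocycles R (ideal_module R J) ys i \<longleftrightarrow>
    (\<forall>I\<in>cech_index ys (Suc i). \<exists>t::nat. cech_elem R ys I [^] t \<otimes> cech_num ys m k I = \<zero>)"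
proof -
  have z: "(\<lambda>_. \<zero>) \<in> A \<rightarrow> J" for A :: "nat set set" using ideal_facts(2)[OF J] by simp
  have eq: "frac_eq (cech_elem R ys I) (cech_num ys m k I) k \<zero> 0
      \<longleftrightarrow> (\<exists>t::nat. cech_elem R ys I [^] t \<otimes> cech_num ys m k I = \<zero>)"
    if I: "I \<in> cech_index ys (Suc i)" for I
    using cech_elem_closed[OF ys I] cech_num_closed[OF J ys m I] ideal_facts(1)[OF J]
    by (simp add: frac_eq_def)
  have "cech_chain J ys i m k \<in> cech_cocycles R (ideal_module R J) ys i \<longleftrightarrow>
      cech_chain J ys (Suc i) (cech_num ys m k) k = cech_chain J ys (Suc i) (\<lambda>_. \<zero>) 0"
    using cech_chain_closed[OF m, of k]
    by (simp add: cech_cocycles_def cech_diff_chain[OF J ys m] cech_chain_zero[OF J ys])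
  also have "\<dots> \<longleftrightarrow> (\<forall>I\<in>cech_index ys (Suc i).
      frac_eq (cech_elem R ys I) (cech_num ys m k I) k \<zero> 0)"
    using cech_num_closed[OF J ys m] z by (intro cech_chain_eq_iff[OF J ys]) auto
  finally show ?thesis using eq by simp
qed

end

section \<open>The Frobenius on Cech cochains\<close>

context frobenius_splitting
begin

text \<open>Additivity applied to \<open>\<one> \<oplus> \<ominus> \<one>\<close> yields
  \<open>(\<ominus> \<one>) [^] p = \<ominus> \<one>\<close> for odd \<open>p\<close> and for
  \<open>p = 2\<close> at once.\<close>

lemma sign_pow_p: "((\<ominus> \<one>) [^] (s::nat)) [^] p = (\<ominus> \<one>) [^] s"
proof -
  have "(\<one> \<oplus> \<ominus> \<one>) [^] p = \<one> [^] p \<oplus> (\<ominus> \<one>) [^] p"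
    by (rule frob_add) auto
  then have "\<one> \<oplus> (\<ominus> \<one>) [^] p = \<zero>"
    by (simp add: r_neg zero_pow_p)
  then have "(\<ominus> \<one>) [^] p = \<ominus> \<one>"
    by (metis a_comm minus_equality nat_pow_closed one_closed add.inv_closed)
  then show ?thesis
    by (metis nat_pow_pow mult.commute add.inv_closed one_closed)
qed

lemma frob_finsum:
  assumes "finite A" "m \<in> A \<rightarrow> carrier R"
  shows "(finsum R m A) [^] p = (\<Oplus>i\<in>A. m i [^] p)"
  using assms
proof (induction A rule: finite_induct)
  case empty
  then show ?case by (simp add: zero_pow_p)
next
  case (insert i A)
  then show ?case
    by (subst (1 2) finsum_insert) (auto simp: frob_add finsum_closed)
qed

lemma split_finsum:
  assumes "finite A" "m \<in> A \<rightarrow> carrier R"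
  shows "\<phi> (finsum R m A) = (\<Oplus>i\<in>A. \<phi> (m i))"
  using assms
proof (induction A rule: finite_induct)
  case empty
  then show ?case by (simp add: split_zero)
next
  case (insert i A)
  then show ?case
    by (subst (1 2) finsum_insert) (auto simp: split_add finsum_closed)
qed

lemma cech_num_frob:
  assumes ys: "set ys \<subseteq> carrier R" and I: "I \<in> cech_index ys (Suc i)"
    and m: "m \<in> cech_index ys i \<rightarrow> carrier R"
  shows "cech_num ys (\<lambda>I. m I [^] p) (k * p) I = cech_num ys m k I [^] p"
proof -
  let ?s = "\<lambda>j. (\<ominus> \<one>) [^] card {l \<in> I. l < j}"
  note y = nth_cech[OF ys I] and mc = funcset_mem[OF m cech_index_remove[OF I]]
  have "cech_num ys m k I [^] p = (\<Oplus>j\<in>I. (?s j \<otimes> ((ys ! j) [^] k \<otimes> m (I - {j}))) [^] p)"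
    unfolding cech_num_def using y mc by (intro frob_finsum cech_indexD(1)[OF I]) auto
  also have "\<dots> = cech_num ys (\<lambda>I. m I [^] p) (k * p) I"
    unfolding cech_num_def using y mc
    by (intro finsum_cong') (auto simp: nat_pow_distrib nat_pow_pow sign_pow_p)
  finally show ?thesis by simp
qed

text \<open>With the exponent \<open>l * p\<close>, each coefficient, a sign times a power of some
  \<open>y\<^sub>j\<close>, is the \<open>p\<close>-th power of the corresponding coefficient for
  the exponent \<open>l\<close>. Hence \<open>\<phi>\<close> commutes with the differential.\<close>

lemma cech_num_split:
  assumes ys: "set ys \<subseteq> carrier R" and I: "I \<in> cech_index ys (Suc i)"
    and n: "n \<in> cech_index ys i \<rightarrow> carrier R"
  shows "\<phi> (cech_num ys n (l * p) I) = cech_num ys (\<lambda>I. \<phi> (n I)) l I"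
proof -
  let ?s = "\<lambda>j. (\<ominus> \<one>) [^] card {l \<in> I. l < j}"
  note y = nth_cech[OF ys I] and nc = funcset_mem[OF n cech_index_remove[OF I]]
  have "\<phi> (?s j \<otimes> ((ys ! j) [^] (l * p) \<otimes> n (I - {j}))) = ?s j \<otimes> ((ys ! j) [^] l \<otimes> \<phi> (n (I - {j})))"
    if j: "j \<in> I" for j
  proof -
    have "?s j \<otimes> ((ys ! j) [^] (l * p) \<otimes> n (I - {j}))
        = (?s j \<otimes> (ys ! j) [^] l) [^] p \<otimes> n (I - {j})"
      using y[OF j] nc[OF j] by (simp add: nat_pow_distrib nat_pow_pow sign_pow_p m_assoc)
    then show ?thesis
      using y[OF j] nc[OF j] by (simp add: split_mult m_assoc)
  qed
  then have "(\<Oplus>j\<in>I. \<phi> (?s j \<otimes> ((ys ! j) [^] (l * p) \<otimes> n (I - {j}))))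
      = cech_num ys (\<lambda>I. \<phi> (n I)) l I"
    unfolding cech_num_def using y nc by (intro finsum_cong') auto
  moreover have "\<phi> (cech_num ys n (l * p) I)
      = (\<Oplus>j\<in>I. \<phi> (?s j \<otimes> ((ys ! j) [^] (l * p) \<otimes> n (I - {j}))))"
    unfolding cech_num_def using y nc by (intro split_finsum cech_indexD(1)[OF I]) auto
  ultimately show ?thesis by simp
qed

lemma frac_eq_split:
  assumes "frac_eq f (m [^] p) (k * p) n (l * p)"
    and c: "f \<in> carrier R" "m \<in> carrier R" "n \<in> carrier R"
  shows "frac_eq f m k (\<phi> n) l"
proof -
  obtain t :: nat where t: "f [^] t \<otimes> (f [^] (l * p) \<otimes> m [^] p) = f [^] t \<otimes> (f [^] (k * p) \<otimes> n)"
    using assms by (auto simp: frac_eq_def)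
  \<comment> \<open>The factor \<open>f [^] t\<close> has to become a \<open>p\<close>-th power
    before \<open>\<phi>\<close> is applied; multiplying by \<open>f [^] (t * q)\<close> with
    \<open>q = p - 1\<close> completes it to \<open>f [^] (t * p)\<close>.\<close>
  obtain q where q: "p = Suc q" using p_pos by (cases p) auto
  have tp: "(f [^] t) [^] p = f [^] (t * q) \<otimes> f [^] t"
    using c by (simp add: nat_pow_pow nat_pow_mult q add.commute)
  have "(f [^] t \<otimes> (f [^] l \<otimes> m)) [^] p = f [^] (t * q) \<otimes> (f [^] t \<otimes> (f [^] (l * p) \<otimes> m [^] p))"
    using c by (simp add: nat_pow_distrib tp nat_pow_pow[of f l p] m_assoc)
  also have "\<dots> = (f [^] t \<otimes> f [^] k) [^] p \<otimes> n"
    unfolding t using c by (simp add: nat_pow_distrib tp nat_pow_pow[of f k p] m_assoc)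
  finally have "\<phi> ((f [^] t \<otimes> (f [^] l \<otimes> m)) [^] p) = \<phi> ((f [^] t \<otimes> f [^] k) [^] p \<otimes> n)"
    by simp
  then have "f [^] t \<otimes> (f [^] l \<otimes> m) = f [^] t \<otimes> (f [^] k \<otimes> \<phi> n)"
    using c by (simp add: split_pow split_mult m_assoc)
  then show ?thesis unfolding frac_eq_def by blast
qed

context
  fixes M N :: "'a set"
  assumes M: "ideal M R" and N: "ideal N R"
    and NM: "\<And>a. a \<in> N \<Longrightarrow> a [^] p \<in> M" and MN: "\<And>f. f \<in> M \<Longrightarrow> \<phi> f \<in> N"
begin

lemma cech_cocycle_frob:
  assumes ys: "set ys \<subseteq> carrier R" and m: "m \<in> cech_index ys i \<rightarrow> N"
    and coc: "cech_chain N ys i m k \<in> cech_cocycles R (ideal_module R N) ys i"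
  shows "cech_chain M ys i (\<lambda>I. m I [^] p) (k * p) \<in> cech_cocycles R (ideal_module R M) ys i"
proof -
  have m': "(\<lambda>I. m I [^] p) \<in> cech_index ys i \<rightarrow> M" using m NM by auto
  have mc: "m \<in> cech_index ys i \<rightarrow> carrier R" using m ideal_facts(1)[OF N] by auto
  have "\<exists>t::nat. cech_elem R ys I [^] t \<otimes> cech_num ys (\<lambda>I. m I [^] p) (k * p) I = \<zero>"
    if I: "I \<in> cech_index ys (Suc i)" for I
  proof -
    let ?f = "cech_elem R ys I"
    have f: "?f \<in> carrier R" by (rule cech_elem_closed[OF ys I])
    have n: "cech_num ys m k I \<in> carrier R"
      using cech_num_closed[OF N ys m I] ideal_facts(1)[OF N] by blast
    obtain t :: nat where "?f [^] t \<otimes> cech_num ys m k I = \<zero>"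
      using coc I cech_chain_cocycle_iff[OF N ys m] by blast
    then have "(?f [^] t \<otimes> cech_num ys m k I) [^] p = \<zero>"
      by (simp add: zero_pow_p)
    then have "?f [^] (t * p) \<otimes> cech_num ys (\<lambda>I. m I [^] p) (k * p) I = \<zero>"
      using f n by (simp add: nat_pow_distrib nat_pow_pow cech_num_frob[OF ys I mc])
    then show ?thesis by blast
  qed
  then show ?thesis
    by (simp add: cech_chain_cocycle_iff[OF M ys m'])
qed

text \<open>This is the injectivity on cohomology: if \<open>n\<close> is a primitive of the
  \<open>p\<close>-th power of the cochain, then \<open>\<phi>\<close> applied to the numerators of
  \<open>n\<close> gives a primitive of the cochain itself, because
  \<open>\<phi>(m\<^sup>p) = m\<close>.\<close>

lemma cech_coboundary_split:
  assumes ys: "set ys \<subseteq> carrier R" and m: "m \<in> cech_index ys i \<rightarrow> N"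
    and cob: "cech_chain M ys i (\<lambda>I. m I [^] p) (k * p) \<in> cech_coboundaries R (ideal_module R M) ys i"
  shows "cech_chain N ys i m k \<in> cech_coboundaries R (ideal_module R N) ys i"
proof -
  note Mf = ideal_facts[OF M] and Nf = ideal_facts[OF N]
  have m': "(\<lambda>I. m I [^] p) \<in> cech_index ys i \<rightarrow> M" using m NM by auto
  have split: "cech_chain N ys i m k = cech_chain N ys i (\<lambda>I. \<phi> (n I)) l"
    if n: "n \<in> cech_index ys i \<rightarrow> M"
      and e: "cech_chain M ys i (\<lambda>I. m I [^] p) (k * p) = cech_chain M ys i n (l * p)" for n l
  proof -
    have "frac_eq (cech_elem R ys I) (m I) k (\<phi> (n I)) l" if I: "I \<in> cech_index ys i" for I
      using e I cech_chain_eq_iff[OF M ys m' n] funcset_mem[OF m I] funcset_mem[OF n I] Mf(1) Nf(1)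
      by (intro frac_eq_split cech_elem_closed[OF ys I]) auto
    moreover have "(\<lambda>I. \<phi> (n I)) \<in> cech_index ys i \<rightarrow> N" using n MN by auto
    ultimately show ?thesis by (simp add: cech_chain_eq_iff[OF N ys m])
  qed
  show ?thesis
  proof (cases i)
    case 0
    \<comment> \<open>In cohomological degree \<open>0\<close> the only coboundary is zero; it is
      given the exponent \<open>0 * p\<close> to match \<open>split\<close>.\<close>
    then have "cech_chain M ys i (\<lambda>I. m I [^] p) (k * p) = cech_chain M ys i (\<lambda>_. \<zero>) (0 * p)"
      using cob by (simp add: cech_coboundaries_def cech_chain_zero[OF M ys])
    then have "cech_chain N ys i m k = cech_chain N ys i (\<lambda>_. \<phi> \<zero>) 0"
      using Mf(2) by (intro split) auto
    then show ?thesis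
      using 0 by (simp add: split_zero cech_coboundaries_def cech_chain_zero[OF N ys])
  next
    case (Suc j)
    obtain n l where n: "n \<in> cech_index ys j \<rightarrow> M"
      "cech_chain M ys i (\<lambda>I. m I [^] p) (k * p) = cech_chain M ys i (cech_num ys n (l * p)) (l * p)"
      using cech_boundary_chain[OF M ys _ p_pos, of "cech_chain M ys i (\<lambda>I. m I [^] p) (k * p)" j 0] cob
      unfolding Suc by metis
    have nc: "n \<in> cech_index ys j \<rightarrow> carrier R" using n(1) Mf(1) by auto
    have n': "(\<lambda>I. \<phi> (n I)) \<in> cech_index ys j \<rightarrow> N" using n(1) MN by auto
    have "cech_chain N ys i m k = cech_chain N ys i (\<lambda>I. \<phi> (cech_num ys n (l * p) I)) l"
      using cech_num_closed[OF M ys n(1)] Suc by (intro split n(2)) auto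
    also have "\<dots> = cech_chain N ys i (cech_num ys (\<lambda>I. \<phi> (n I)) l) l"
      using cech_num_split[OF ys _ nc] Suc by (intro cech_chain_cong) auto
    finally show ?thesis
      unfolding Suc using cech_boundary_chain_mem[OF N ys n', of l] by simp
  qed
qed

end

end

section \<open>Gradings\<close>

context cring
begin

context
  fixes G :: "nat \<Rightarrow> 'a set"
  assumes G: "graded_ring R G"
begin

lemma graded_closed: "x \<in> G n \<Longrightarrow> x \<in> carrier R"
  using G additive_subgroup.a_Hcarr unfolding graded_ring_def by metis

lemma graded_zero: "\<zero> \<in> G n"
  using G additive_subgroup.zero_closed unfolding graded_ring_def by metis

lemma graded_one: "\<one> \<in> G 0"
  using G unfolding graded_ring_def by metis

lemma graded_mult: "a \<in> G i \<Longrightarrow> b \<in> G j \<Longrightarrow> a \<otimes> b \<in> G (i + j)"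
  using G unfolding graded_ring_def by metis

lemma graded_pow: "a \<in> G d \<Longrightarrow> a [^] (n::nat) \<in> G (n * d)"
proof (induction n)
  case 0
  then show ?case by (simp add: graded_one)
next
  case (Suc n)
  then show ?case using graded_mult[of "a [^] n" "n * d" a d] by (simp add: add.commute)
qed

lemma graded_cech_elem:
  assumes ys: "set ys \<subseteq> G 1" and I: "I \<in> cech_index ys i"
  shows "cech_elem R ys I \<in> G i"
proof -
  have y: "ys ! j \<in> G 1" if "j \<in> I" for j
    using ys cech_indexD(2)[OF I] that by (meson lessThan_iff nth_mem subsetD)
  have "finprod R (\<lambda>j. ys ! j) I \<in> G (card I)"
    using cech_indexD(1)[OF I] y
  proof (induction I rule: finite_induct)
    case empty
    then show ?case by (simp add: graded_one)
  next
    case (insert j I)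
    then show ?case
      using graded_closed graded_mult[of "ys ! j" 1 "finprod R (\<lambda>j. ys ! j) I" "card I"]
      by (subst finprod_insert) auto
  qed
  then show ?thesis
    using cech_indexD(3)[OF I] by (simp add: cech_elem_def)
qed

lemma ideal_grading_zero:
  assumes "ideal J R"
  shows "\<zero> \<in> ideal_grading R G J x"
  using ideal_facts(2)[OF assms] graded_zero by (simp add: ideal_grading_def)

lemma ideal_grading_subset:
  assumes "ideal J R"
  shows "ideal_grading R G J x \<subseteq> J"
  using ideal_facts(2)[OF assms] by (auto simp: ideal_grading_def)

lemma ideal_grading_mult:
  assumes J: "ideal J R" and f: "f \<in> G d" and m: "m \<in> ideal_grading R G J x"
  shows "f \<otimes> m \<in> ideal_grading R G J (x + int d)"
proof (cases "x < 0")
  case True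
  then have "f \<otimes> m = \<zero>" using m f graded_closed by (simp add: ideal_grading_def)
  then show ?thesis using ideal_grading_zero[OF J] by simp
next
  case False
  then have "m \<in> J" "m \<in> G (nat x)" "nat (x + int d) = d + nat x" "0 \<le> x + int d"
    using m by (auto simp: ideal_grading_def)
  then show ?thesis
    using graded_mult[OF f] graded_closed[OF f] ideal_facts(6)[OF J]
    by (simp add: ideal_grading_def)
qed

lemma ideal_grading_pow:
  assumes M: "ideal M R" and NM: "\<And>a. a \<in> N \<Longrightarrow> a [^] p \<in> M" and p: "0 < (p::nat)"
    and m: "m \<in> ideal_grading R G N x"
  shows "m [^] p \<in> ideal_grading R G M (int p * x)"
proof (cases "x < 0")
  case True
  then have "m [^] p = \<zero>" using m p by (simp add: ideal_grading_def nat_pow_zero)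
  then show ?thesis using ideal_grading_zero[OF M] by simp
next
  case False
  then have "m \<in> N" "m \<in> G (nat x)" "nat (int p * x) = p * nat x" "\<not> int p * x < 0"
    using m p by (auto simp: ideal_grading_def nat_mult_distrib mult_less_0_iff)
  then show ?thesis
    using graded_pow[of m "nat x" p] NM by (simp add: ideal_grading_def)
qed

text \<open>Since \<open>y\<^sub>I\<close> has degree \<open>i\<close>, a component of degree
  \<open>n\<close> with denominator exponent \<open>k\<close> has a numerator of degree
  \<open>n + k i\<close>. Expanding the fraction raises numerator and denominator degrees equally,
  so a common exponent is compatible with the grading.\<close>

lemma cech_chain_degree:
  assumes J: "ideal J R" and ys: "set ys \<subseteq> G 1"
    and c: "c \<in> carrier (cech_module R (ideal_module R J) ys i)"
    and deg: "\<And>I. I \<in> cech_index ys i \<Longrightarrow> c I \<in>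
      loc_degree R (ideal_module R J) (ideal_grading R G J) (cech_elem R ys I) (card I) n"
  obtains m k where "m \<in> cech_index ys i \<rightarrow> J" "c = cech_chain J ys i m k"
    "m \<in> cech_index ys i \<rightarrow> ideal_grading R G J (n + int (k * i))"
proof -
  have ysc: "set ys \<subseteq> carrier R" using ys graded_closed by blast
  have "\<exists>m k. m \<in> ideal_grading R G J (n + int (k * i)) \<and> c I = frac J (cech_elem R ys I) m k"
    if "I \<in> cech_index ys i" for I
    using deg[OF that] cech_indexD(3)[OF that] unfolding loc_degree_def by blast
  then obtain m k where mk: "\<And>I. I \<in> cech_index ys i \<Longrightarrow> m I \<in> ideal_grading R G J (n + int (k I * i))"
    "\<And>I. I \<in> cech_index ys i \<Longrightarrow> c I = frac J (cech_elem R ys I) (m I) (k I)"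
    by metis
  have mJ: "m \<in> cech_index ys i \<rightarrow> J" using mk(1) ideal_grading_subset[OF J] by blast
  let ?K = "sum k (cech_index ys i)"
  let ?m = "\<lambda>I. cech_elem R ys I [^] (?K - k I) \<otimes> m I"
  have "c = cech_chain J ys i ?m ?K"
    using mk cech_index_bound by (intro cech_common_denominator[OF J ysc c _ mJ]) auto
  moreover have deg': "?m \<in> cech_index ys i \<rightarrow> ideal_grading R G J (n + int (?K * i))"
  proof
    fix I assume I: "I \<in> cech_index ys i"
    have "cech_elem R ys I [^] (?K - k I) \<in> G ((?K - k I) * i)"
      by (intro graded_pow graded_cech_elem[OF ys I])
    then have "?m I \<in> ideal_grading R G J (n + int (k I * i) + int ((?K - k I) * i))"
      by (intro ideal_grading_mult[OF J] mk(1)[OF I])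
    moreover have "k I * i + (?K - k I) * i = ?K * i"
      using cech_index_bound[OF I, of k] by (metis add_mult_distrib le_add_diff_inverse)
    then have "n + int (k I * i) + int ((?K - k I) * i) = n + int (?K * i)"
      by (metis add.assoc of_nat_add)
    ultimately show "?m I \<in> ideal_grading R G J (n + int (?K * i))" by (simp only:)
  qed
  moreover have "?m \<in> cech_index ys i \<rightarrow> J"
    using deg' ideal_grading_subset[OF J] by blast
  ultimately show ?thesis using that by blast
qed

lemma cech_chain_loc_degree:
  assumes "m \<in> cech_index ys i \<rightarrow> ideal_grading R G J (n + int (k * i))" "I \<in> cech_index ys i"
  shows "cech_chain J ys i m k I \<in>
    loc_degree R (ideal_module R J) (ideal_grading R G J) (cech_elem R ys I) (card I) n"
  using assms cech_indexD(3)[OF assms(2)] unfolding cech_chain_def loc_degree_def by auto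

lemma zero_cocycle_degree:
  assumes J: "ideal J R" and ys: "set ys \<subseteq> G 1"
  shows "\<zero>\<^bsub>cech_module R (ideal_module R J) ys i\<^esub> \<in> cech_cocycles R (ideal_module R J) ys i"
    and "I \<in> cech_index ys i \<Longrightarrow> \<zero>\<^bsub>cech_module R (ideal_module R J) ys i\<^esub> I \<in>
      loc_degree R (ideal_module R J) (ideal_grading R G J) (cech_elem R ys I) (card I) n"
proof -
  have ysc: "set ys \<subseteq> carrier R" using ys graded_closed by blast
  have z: "(\<lambda>_. \<zero>) \<in> cech_index ys i \<rightarrow> J" using ideal_facts(2)[OF J] by simp
  show "\<zero>\<^bsub>cech_module R (ideal_module R J) ys i\<^esub> \<in> cech_cocycles R (ideal_module R J) ys i"
    unfolding cech_chain_zero[OF J ysc, of i 0, symmetric] cech_chain_cocycle_iff[OF J ysc z]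
    using cech_elem_closed[OF ysc] cech_num_zero[OF ysc] by simp
  show "I \<in> cech_index ys i \<Longrightarrow> \<zero>\<^bsub>cech_module R (ideal_module R J) ys i\<^esub> I \<in>
      loc_degree R (ideal_module R J) (ideal_grading R G J) (cech_elem R ys I) (card I) n"
    unfolding cech_chain_zero[OF J ysc, of i 0, symmetric]
    using ideal_grading_zero[OF J] by (intro cech_chain_loc_degree) auto
qed

text \<open>The zero cochain is a cocycle of every degree, so the zero class always occurs. Hence
  the graded part differs from the zero part exactly when it contains a further class.\<close>

lemma local_cohomology_degree_nonzero_iff:
  assumes J: "ideal J R" and ys: "set ys \<subseteq> G 1"
  shows "local_cohomology_degree R (ideal_module R J) (ideal_grading R G J) ys i n
      \<noteq> {cech_coboundaries R (ideal_module R J) ys i} \<longleftrightarrow>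
    (\<exists>c\<in>cech_cocycles R (ideal_module R J) ys i - cech_coboundaries R (ideal_module R J) ys i.
       \<forall>I\<in>cech_index ys i. c I \<in>
         loc_degree R (ideal_module R J) (ideal_grading R G J) (cech_elem R ys I) (card I) n)"
    (is "?H \<noteq> {?B} \<longleftrightarrow> ?R")
proof -
  let ?C = "cech_module R (ideal_module R J) ys i"
  let ?D = "{c \<in> cech_cocycles R (ideal_module R J) ys i. \<forall>I\<in>cech_index ys i. c I \<in>
         loc_degree R (ideal_module R J) (ideal_grading R G J) (cech_elem R ys I) (card I) n}"
  have ysc: "set ys \<subseteq> carrier R" using ys graded_closed by blast
  have H: "?H = (\<lambda>c. ?B +>\<^bsub>?C\<^esub> c) ` ?D" by (simp add: local_cohomology_degree_def)
  have coset: "?B +>\<^bsub>?C\<^esub> c = ?B \<longleftrightarrow> c \<in> ?B" if "c \<in> ?D" for c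
    using that cech_coset_eq_iff[OF J ysc] by (simp add: cech_cocycles_def)
  have "\<zero>\<^bsub>?C\<^esub> \<in> ?D" using zero_cocycle_degree[OF J ys] by simp
  then have "?H \<noteq> {?B} \<longleftrightarrow> (\<exists>c\<in>?D. ?B +>\<^bsub>?C\<^esub> c \<noteq> ?B)" unfolding H by blast
  also have "\<dots> \<longleftrightarrow> (\<exists>c\<in>?D. c \<notin> ?B)" using coset by (intro bex_cong) auto
  also have "\<dots> \<longleftrightarrow> ?R" by blast
  finally show ?thesis .
qed

end

end

section \<open>Comparison of a-invariants\<close>

text \<open>A numerator of degree \<open>n + k i\<close> over the exponent \<open>k\<close> has a
  \<open>p\<close>-th power of degree \<open>p n + k p i\<close> over the exponent
  \<open>k p\<close>. A nonzero class of degree \<open>n\<close> therefore yields one of degree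
  \<open>p n\<close>.\<close>

lemma (in frobenius_splitting) a_invariant_split_le:
  assumes G: "graded_ring R G" and ys: "set ys \<subseteq> G 1" and M: "ideal M R" and N: "ideal N R"
    and NM: "\<And>a. a \<in> N \<Longrightarrow> a [^] p \<in> M" and MN: "\<And>f. f \<in> M \<Longrightarrow> \<phi> f \<in> N"
  shows "ereal (real p) * a_invariant R (ideal_module R N) (ideal_grading R G N) ys i
    \<le> a_invariant R (ideal_module R M) (ideal_grading R G M) ys i"
proof -
  let ?H = "\<lambda>J. local_cohomology_degree R (ideal_module R J) (ideal_grading R G J) ys i"
  let ?B = "\<lambda>J. cech_coboundaries R (ideal_module R J) ys i"
  let ?a = "\<lambda>J. a_invariant R (ideal_module R J) (ideal_grading R G J) ys i"
  have ysc: "set ys \<subseteq> carrier R" using ys graded_closed[OF G] by blast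
  have step: "?H M (int p * n) \<noteq> {?B M}" if n: "?H N n \<noteq> {?B N}" for n
  proof -
    obtain c where c: "c \<in> cech_cocycles R (ideal_module R N) ys i" "c \<notin> ?B N"
      "\<And>I. I \<in> cech_index ys i \<Longrightarrow> c I \<in>
         loc_degree R (ideal_module R N) (ideal_grading R G N) (cech_elem R ys I) (card I) n"
      using n unfolding local_cohomology_degree_nonzero_iff[OF G N ys] by blast
    have "c \<in> carrier (cech_module R (ideal_module R N) ys i)"
      using c(1) by (simp add: cech_cocycles_def)
    then obtain m k where m: "m \<in> cech_index ys i \<rightarrow> N" "c = cech_chain N ys i m k"
      "m \<in> cech_index ys i \<rightarrow> ideal_grading R G N (n + int (k * i))"
      using cech_chain_degree[OF G N ys _ c(3)] by metis
    let ?c = "cech_chain M ys i (\<lambda>I. m I [^] p) (k * p)"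
    have "?c \<in> cech_cocycles R (ideal_module R M) ys i"
      using cech_cocycle_frob[OF M N NM MN ysc m(1)] c(1) m(2) by blast
    moreover have "?c \<notin> ?B M"
      using cech_coboundary_split[OF M N NM MN ysc m(1)] c(2) m(2) by blast
    moreover have "(\<lambda>I. m I [^] p) \<in> cech_index ys i \<rightarrow> ideal_grading R G M (int p * n + int (k * p * i))"
    proof
      fix I assume "I \<in> cech_index ys i"
      then have "m I [^] p \<in> ideal_grading R G M (int p * (n + int (k * i)))"
        using m(3) by (intro ideal_grading_pow[OF G M NM p_pos]) auto
      moreover have "int p * (n + int (k * i)) = int p * n + int (k * p * i)"
        by (simp add: algebra_simps)
      ultimately show "m I [^] p \<in> ideal_grading R G M (int p * n + int (k * p * i))" by simp
    qed
    ultimately show ?thesis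
      unfolding local_cohomology_degree_nonzero_iff[OF G M ys]
      using cech_chain_loc_degree[OF G] by blast
  qed
  \<comment> \<open>A nonzero class in one degree also shows that the whole cohomology is nonzero,
    which rules out the default value \<open>-\<infinity>\<close>.\<close>
  have upper: "ereal (real_of_int n) \<le> ?a J" if n: "?H J n \<noteq> {?B J}" and J: "ideal J R" for J n
  proof -
    obtain c where c: "c \<in> cech_cocycles R (ideal_module R J) ys i" "c \<notin> ?B J"
      using n unfolding local_cohomology_degree_nonzero_iff[OF G J ys] by blast
    have "?B J +>\<^bsub>cech_module R (ideal_module R J) ys i\<^esub> c \<noteq> ?B J"
      using c cech_coset_eq_iff[OF J ysc] by (simp add: cech_cocycles_def)
    then have "local_cohomology R (ideal_module R J) ys i \<noteq> {?B J}"
      using c(1) unfolding local_cohomology_def by blast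
    then show ?thesis
      using n unfolding a_invariant_def by (auto intro: Sup_upper)
  qed
  have p0: "0 < ereal (real p)" "ereal (real p) \<noteq> \<infinity>" using p_pos by auto
  \<comment> \<open>With the factor \<open>p\<close> moved to the right, the left side is a plain
    supremum and can be bounded elementwise.\<close>
  have "?a N \<le> ?a M / ereal (real p)"
  proof (cases "local_cohomology R (ideal_module R N) ys i = {?B N}")
    case True
    then show ?thesis by (simp add: a_invariant_def)
  next
    case False
    then have "?a N = Sup {ereal (real_of_int n) |n. ?H N n \<noteq> {?B N}}"
      by (simp add: a_invariant_def)
    also have "\<dots> \<le> ?a M / ereal (real p)"
    proof (rule Sup_least)
      fix x assume "x \<in> {ereal (real_of_int n) |n. ?H N n \<noteq> {?B N}}"
      then obtain n where n: "x = ereal (real_of_int n)" "?H N n \<noteq> {?B N}" by blast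
      have "ereal (real p) * x \<le> ?a M"
        using upper[OF step[OF n(2)] M] n(1) by simp
      then show "x \<le> ?a M / ereal (real p)"
        using p0 by (simp add: ereal_le_divide_pos)
    qed
    finally show ?thesis .
  qed
  then show ?thesis using p0 by (simp add: ereal_le_divide_pos)
qed

section \<open>Filtrations\<close>

text \<open>This adjunction characterizes the rounded quotient; the arguments about rounding below
  reduce to it.\<close>

lemma nat_ceiling_divide_le_iff:
  assumes "0 < d"
  shows "nat \<lceil>real n / real d\<rceil> \<le> x \<longleftrightarrow> n \<le> x * d"
proof -
  have "nat \<lceil>real n / real d\<rceil> \<le> x \<longleftrightarrow> real n / real d \<le> real x"
    by (simp add: nat_le_iff ceiling_le_iff)
  also have "\<dots> \<longleftrightarrow> real n \<le> real (x * d)"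
    using assms by (simp add: divide_le_eq)
  finally show ?thesis by (simp only: of_nat_le_iff)
qed

text \<open>Both sides have the same upper bounds \<open>x\<close>, namely those with
  \<open>n \<le> x p p\<^sup>e\<close>. Dividing by \<open>p\<close> once per step of the induction
  on \<open>e\<close> thus gives the right index.\<close>

lemma nat_ceiling_divide_power_Suc:
  assumes "0 < p"
  shows "nat \<lceil>real n / real (p ^ Suc e)\<rceil> = nat \<lceil>real (nat \<lceil>real n / real (p ^ e)\<rceil>) / real p\<rceil>"
proof (rule order_class.order_eq_iff[THEN iffD2], rule conjI)
  let ?a = "nat \<lceil>real n / real (p ^ e)\<rceil>"
  have "nat \<lceil>real n / real (p ^ Suc e)\<rceil> \<le> x \<longleftrightarrow> nat \<lceil>real ?a / real p\<rceil> \<le> x" for x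
    using nat_ceiling_divide_le_iff[of "p ^ Suc e" n x] nat_ceiling_divide_le_iff[of p ?a x]
      nat_ceiling_divide_le_iff[of "p ^ e" n "x * p"] assms
    by (simp add: mult.assoc del: of_nat_power)
  then show "nat \<lceil>real n / real (p ^ Suc e)\<rceil> \<le> nat \<lceil>real ?a / real p\<rceil>"
    "nat \<lceil>real ?a / real p\<rceil> \<le> nat \<lceil>real n / real (p ^ Suc e)\<rceil>"
    by blast+
qed

lemma (in cring) filtration_antimono:
  assumes "ideal_filtration R I" "m \<le> n"
  shows "I n \<subseteq> I m"
proof -
  have "I (Suc k) \<subseteq> I k" for k using assms(1) unfolding ideal_filtration_def by blast
  then show ?thesis using assms(2) by (rule lift_Suc_antimono_le)
qed

lemma (in cring) filtration_pow:
  assumes I: "ideal_filtration R I" and a: "a \<in> I k"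
  shows "a [^] (n::nat) \<in> I (n * k)"
proof (induction n)
  case 0
  then show ?case using I by (simp add: ideal_filtration_def)
next
  case (Suc n)
  then have "a [^] n \<otimes> a \<in> ideal_prod R (I (n * k)) (I k)"
    using a by (rule ideal_prod.prod)
  then have "a [^] n \<otimes> a \<in> I (n * k + k)"
    using I unfolding ideal_filtration_def by blast
  then show ?case by (simp add: add.commute)
qed

lemma (in cring) frobenius_splitting_of_filtration:
  assumes "char_p p R" and sp: "filtration_splitting p R I \<phi>"
  shows "frobenius_splitting R p (\<lambda>f. \<phi> (Root f))"
proof -
  have lin: "\<phi> \<in> lin_maps R (root_ring p R) (ideal_module R (carrier R))"
    and id: "\<And>a. a \<in> carrier R \<Longrightarrow> \<phi> (root_incl p R a) = a"
    using sp by (auto simp: filtration_splitting_def)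
  show ?thesis
  proof (unfold_locales)
    show "char_p p R" by (rule assms)
    show "\<phi> (Root f) \<in> carrier R" if "f \<in> carrier R" for f
      using lin that by (auto simp: lin_maps_def root_ring_def)
    show "\<phi> (Root (f \<oplus> g)) = \<phi> (Root f) \<oplus> \<phi> (Root g)" if "f \<in> carrier R" "g \<in> carrier R" for f g
      using lin that by (auto simp: lin_maps_def root_ring_def)
    show "\<phi> (Root (a [^] p \<otimes> f)) = a \<otimes> \<phi> (Root f)" if "a \<in> carrier R" "f \<in> carrier R" for a f
      using lin that by (auto simp: lin_maps_def root_ring_def)
    show "\<phi> (Root (a [^] p)) = a" if "a \<in> carrier R" for a
      using id[OF that] by (simp add: root_incl_def)
  qed
qed

lemma (in cring) filtration_frob:
  assumes I: "ideal_filtration R I" and p: "0 < p" and a: "a \<in> I (nat \<lceil>real n / real p\<rceil>)"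
  shows "a [^] p \<in> I n"
proof -
  have "n \<le> p * nat \<lceil>real n / real p\<rceil>"
    using nat_ceiling_divide_le_iff[OF p, of n "nat \<lceil>real n / real p\<rceil>"] by (simp add: mult.commute)
  then show ?thesis
    using filtration_pow[OF I a, of p] filtration_antimono[OF I] by blast
qed

lemma (in cring) filtration_split:
  assumes I: "ideal_filtration R I" and p: "0 < p" and sp: "filtration_splitting p R I \<phi>"
    and f: "f \<in> I n"
  shows "\<phi> (Root f) \<in> I (nat \<lceil>real n / real p\<rceil>)"
proof (cases "nat \<lceil>real n / real p\<rceil>")
  case 0
  have "f \<in> carrier R" using f I ideal_facts(1) by (auto simp: ideal_filtration_def)
  then have "\<phi> (Root f) \<in> carrier R"
    using sp by (auto simp: filtration_splitting_def lin_maps_def root_ring_def)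
  then show ?thesis using I 0 by (simp add: ideal_filtration_def)
next
  case (Suc m)
  \<comment> \<open>The ceiling \<open>Suc m\<close> is not at most \<open>m\<close>, hence
    \<open>n > m * p\<close>. The filtration condition at \<open>m\<close> then lands in
    \<open>I (m + 1)\<close>, which is the required index.\<close>
  then have "m * p + 1 \<le> n"
    using nat_ceiling_divide_le_iff[OF p, of n m] by simp
  then have "f \<in> I (m * p + 1)" using f filtration_antimono[OF I] by blast
  then show ?thesis
    using sp Suc by (auto simp: filtration_splitting_def image_subset_iff)
qed

section \<open>Iteration over powers of \<open>p\<close>\<close>

lemma (in cring) filtration_depth_le:
  assumes "noetherian_ring R" "char_p p R" and I: "ideal_filtration R I"
    and sp: "filtration_splitting p R I \<phi>" and \<mm>: "\<mm> \<subseteq> carrier R"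
  shows "depth R \<mm> (ideal_module R (I n))
    \<le> depth R \<mm> (ideal_module R (I (nat \<lceil>real n / real (p ^ e)\<rceil>)))"
proof -
  interpret frobenius_splitting R p "\<lambda>f. \<phi> (Root f)"
    by (rule frobenius_splitting_of_filtration) fact+
  have ideal: "ideal (I k) R" for k using I by (simp add: ideal_filtration_def)
  show ?thesis
  proof (induction e)
    case 0
    then show ?case by simp
  next
    case (Suc e)
    let ?k = "nat \<lceil>real n / real (p ^ e)\<rceil>"
    have "depth R \<mm> (ideal_module R (I ?k)) \<le> depth R \<mm> (ideal_module R (I (nat \<lceil>real ?k / real p\<rceil>)))"
      using filtration_frob[OF I p_pos] filtration_split[OF I p_pos sp]
      by (intro depth_split_le assms ideal)
    then show ?case
      unfolding nat_ceiling_divide_power_Suc[OF p_pos] using Suc by (rule order_trans[rotated])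
  qed
qed

lemma (in cring) filtration_a_invariant_le:
  assumes "char_p p R" and I: "ideal_filtration R I" and sp: "filtration_splitting p R I \<phi>"
    and G: "graded_ring R G" and ys: "set ys \<subseteq> G 1"
  shows "ereal (real (p ^ e)) * a_invariant R (ideal_module R (I (nat \<lceil>real n / real (p ^ e)\<rceil>)))
        (ideal_grading R G (I (nat \<lceil>real n / real (p ^ e)\<rceil>))) ys i
    \<le> a_invariant R (ideal_module R (I n)) (ideal_grading R G (I n)) ys i"
proof -
  interpret frobenius_splitting R p "\<lambda>f. \<phi> (Root f)"
    by (rule frobenius_splitting_of_filtration) fact+
  have ideal: "ideal (I k) R" for k using I by (simp add: ideal_filtration_def)
  let ?a = "\<lambda>k. a_invariant R (ideal_module R (I k)) (ideal_grading R G (I k)) ys i"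
  show ?thesis
  proof (induction e)
    case 0
    then show ?case by simp
  next
    case (Suc e)
    let ?k = "nat \<lceil>real n / real (p ^ e)\<rceil>"
    have "ereal (real p) * ?a (nat \<lceil>real ?k / real p\<rceil>) \<le> ?a ?k"
      using filtration_frob[OF I p_pos] filtration_split[OF I p_pos sp]
      by (intro a_invariant_split_le G ys ideal)
    \<comment> \<open>The induction hypothesis bounds \<open>p\<^sup>e\<close> times
      \<open>?a ?k\<close>, so the inequality at \<open>?k\<close> is scaled by this nonnegative
      factor, which is monotone in \<open>ereal\<close> even at infinite values.\<close>
    then have "ereal (real (p ^ e)) * (ereal (real p) * ?a (nat \<lceil>real ?k / real p\<rceil>))
        \<le> ereal (real (p ^ e)) * ?a ?k"
      by (rule ereal_mult_left_mono) simp
    also have "\<dots> \<le> ?a n" by (rule Suc)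
    finally have "ereal (real (p ^ e)) * ereal (real p) * ?a (nat \<lceil>real ?k / real p\<rceil>) \<le> ?a n"
      by (simp only: mult.assoc)
    moreover have "ereal (real (p ^ e)) * ereal (real p) = ereal (real (p ^ Suc e))"
      by (simp add: mult.commute)
    ultimately show ?case
      unfolding nat_ceiling_divide_power_Suc[OF p_pos] by (simp only:)
  qed
qed

lemma (in cring) graded_max_ideal_subset:
  assumes "standard_graded R G \<mm>\<^sub>0"
  shows "graded_max_ideal R G \<mm>\<^sub>0 \<subseteq> carrier R"
proof -
  have "graded_ring R G" and max: "maximalideal \<mm>\<^sub>0 (R\<lparr>carrier := G 0\<rparr>)"
    using assms by (auto simp: standard_graded_def local_ring_def)
  have "\<mm>\<^sub>0 \<subseteq> carrier (R\<lparr>carrier := G 0\<rparr>)"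
    using maximalideal.axioms(1)[OF max] ideal.axioms(1) additive_subgroup.a_subset by metis
  then have "\<mm>\<^sub>0 \<subseteq> carrier R"
    using graded_closed[OF \<open>graded_ring R G\<close>] by auto
  moreover have "irrelevant_ideal R G \<subseteq> carrier R"
    by (auto simp: irrelevant_ideal_def)
  ultimately show ?thesis
    unfolding graded_max_ideal_def by (intro set_add_closed)
qed

theorem proposition4p9:
  fixes R :: "('a, 'm) ring_scheme" and p :: nat and I :: "nat \<Rightarrow> 'a set"
  assumes "cring R" and "noetherian_ring R" and "char_p p R" and "F_finite p R" and "F_split p R"
  shows
    "(\<forall>\<mm>. local_ring R \<mm> \<and> F_split_filtration p R I \<longrightarrow>
        (\<forall>n e. depth R \<mm> (ideal_module R (I n))
                 \<le> depth R \<mm> (ideal_module R (I (nat \<lceil>real n / real (p ^ e)\<rceil>)))))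
     \<and>
     (\<forall>G \<mm>\<^sub>0. standard_graded R G \<mm>\<^sub>0 \<and> graded_F_split_filtration p R G I \<longrightarrow>
        (\<forall>n e. depth R (graded_max_ideal R G \<mm>\<^sub>0) (ideal_module R (I n))
                 \<le> depth R (graded_max_ideal R G \<mm>\<^sub>0)
                     (ideal_module R (I (nat \<lceil>real n / real (p ^ e)\<rceil>))))
        \<and>
        (\<forall>ys. degree_one_generators R G ys \<longrightarrow>
           (\<forall>n e i. ereal (real i) \<le> krull_dim (R Quot (I 1)) \<longrightarrow>
              a_invariant R (ideal_module R (I n)) (ideal_grading R G (I n)) ys i
                \<ge> ereal (real (p ^ e)) *
                   a_invariant R (ideal_module R (I (nat \<lceil>real n / real (p ^ e)\<rceil>)))
                     (ideal_grading R G (I (nat \<lceil>real n / real (p ^ e)\<rceil>))) ys i)))"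
proof -
  interpret cring R by fact
  show ?thesis
  proof (intro conjI allI impI; (elim conjE)?)
    fix \<mm> n e
    assume "local_ring R \<mm>" and filt: "F_split_filtration p R I"
    then have "ideal \<mm> R" by (auto simp: local_ring_def intro: maximalideal.axioms(1))
    then have "\<mm> \<subseteq> carrier R" using ideal_facts(1) by blast
    then show "depth R \<mm> (ideal_module R (I n))
        \<le> depth R \<mm> (ideal_module R (I (nat \<lceil>real n / real (p ^ e)\<rceil>)))"
      using filt assms filtration_depth_le unfolding F_split_filtration_def by blast
  next
    fix G \<mm>\<^sub>0 n e
    assume "standard_graded R G \<mm>\<^sub>0" and filt: "graded_F_split_filtration p R G I"
    then show "depth R (graded_max_ideal R G \<mm>\<^sub>0) (ideal_module R (I n))
        \<le> depth R (graded_max_ideal R G \<mm>\<^sub>0) (ideal_module R (I (nat \<lceil>real n / real (p ^ e)\<rceil>)))"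
      using assms graded_max_ideal_subset filtration_depth_le
      unfolding graded_F_split_filtration_def by blast
  next
    fix G \<mm>\<^sub>0 ys n e i
    assume "standard_graded R G \<mm>\<^sub>0" and filt: "graded_F_split_filtration p R G I"
      and "degree_one_generators R G ys"
    then show "ereal (real (p ^ e)) *
          a_invariant R (ideal_module R (I (nat \<lceil>real n / real (p ^ e)\<rceil>)))
            (ideal_grading R G (I (nat \<lceil>real n / real (p ^ e)\<rceil>))) ys i
        \<le> a_invariant R (ideal_module R (I n)) (ideal_grading R G (I n)) ys i"
      using assms filtration_a_invariant_le
      unfolding graded_F_split_filtration_def standard_graded_def degree_one_generators_def by blast
  qed
qed

end
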